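(* Let $\varphi$ be a formula of Presburger arithmetic (in the extended language described in the context) of length $n$, with free variables $x_1,\dots,x_r$. Then the minimal deterministic word automaton representing $\{(a_1,\dots,a_r)\in\mathbb{Z}^r : (\mathbb{Z},<,+)\models\varphi[a_1,\dots,a_r]\}$ has at most $2^{n^{(\operatorname{qbl}(\varphi)+1)^{\operatorname{qa}(\varphi)+4}}}$ states.
   Context: Presburger arithmetic (PA) is first-order logic over $(\mathbb{Z},<,+)$; we use the extended language with constants $0,1$, unary negation $-$, binary $+$, the relations $=,\neq,<,\leq,>,\geq$, and unary predicates $d\mid\cdot$ ("divisible by $d$") for each integer $d\geq 2$; formulas use $\neg,\wedge,\vee,\rightarrow,\leftrightarrow,\exists,\forall$. A constant $c$ abbreviates $1+\dots+1$ ($c$ times) or $-(1+\dots+1)$, and $k\cdot x$ abbreviates $x+\dots+x$ ($k$ times) or $-(x+\dots+x)$ (and $x+(-x)$ if $k=0$). The length of a formula is the number of letters needed to write it, where constants and coefficients are counted in this expanded (unary) form, and the length of $d\mid t$ is the length of $t$ plus $d+1$. Quantifier alternations: $\operatorname{qa}(\varphi)=\min\{\operatorname{qa}_\exists(\varphi),\operatorname{qa}_\forall(\varphi)\}$ where, with $\overline{Q}$ the dual quantifier of $Q$: $\operatorname{qa}_Q(\neg\psi)=\operatorname{qa}_{\overline Q}(\psi)$; $\operatorname{qa}_Q(\psi_1\oplus\psi_2)=\max\{\operatorname{qa}_Q(\psi_1),\operatorname{qa}_Q(\psi_2)\}$ for $\oplus\in\{\wedge,\vee\}$; $\operatorname{qa}_Q(\psi_1\to\psi_2)=\operatorname{qa}_Q(\neg\psi_1\vee\psi_2)$;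 $\operatorname{qa}_Q(\psi_1\leftrightarrow\psi_2)=\operatorname{qa}_Q((\psi_1\to\psi_2)\wedge(\psi_2\to\psi_1))$; $\operatorname{qa}_Q(\overline{Q}x\psi)=1+\operatorname{qa}_{\overline Q}(\psi)$; $\operatorname{qa}_Q(Qx\psi)=\max\{1,\operatorname{qa}_Q(\psi)\}$; and $0$ for atomic formulas. Quantifier block length: $\operatorname{qbl}(\varphi)=\max\{\operatorname{qbl}_Q(\psi): Q\in\{\exists,\forall\},\ \psi \text{ a subformula of }\varphi\}$ where $\operatorname{qbl}_Q(\neg\psi)=\operatorname{qbl}_{\overline Q}(\psi)$; $\operatorname{qbl}_Q(\psi_1\oplus\psi_2)=\operatorname{qbl}_Q(\psi_1)+\operatorname{qbl}_Q(\psi_2)$ for $\oplus\in\{\wedge,\vee\}$; $\to$ and $\leftrightarrow$ are treated via the same rewritings as for $\operatorname{qa}$; $\operatorname{qbl}_Q(Qx\psi)=1+\operatorname{qbl}_Q(\psi)$; and $0$ otherwise (including $\overline{Q}x\psi$ and atomic formulas). Encoding: fix an integer base $\varrho\geq 2$ and $\Sigma=\{0,\dots,\varrho-1\}$. For $b_{n-1}\dots b_0\in\Sigma^*$ let $\langle b_{n-1}\dots b_0\rangle_{\mathbb N}=\sum_{i<n}\varrho^i b_i$; for $b_nb_{n-1}\dots b_0\in\Sigma^+$ let $\langle b_n\dots b_0\rangle_{\mathbb Z}=\langle b_{n-1}\dots b_0\rangle_{\mathbb N}$ if $b_n=0$ and $\langle b_{n-1}\dots b_0\rangle_{\mathbb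 N}-\varrho^n$ if $b_n\neq 0$. A word over $\Sigma^r$ is read componentwise (track $i$ encodes the $i$th integer) giving $\langle w\rangle_{\mathbb Z}\in\mathbb{Z}^r$ for $w\in(\Sigma^r)^+$. A deterministic word automaton (DWA) $\mathcal A$ over $\Sigma^r$ represents $U\subseteq\mathbb{Z}^r$ if $L(\mathcal A)=\{w\in(\Sigma^r)^+:\langle w\rangle_{\mathbb Z}\in U\}$. The size of a DWA is its number of states. *)

theory Defs
  imports Main
begin

section \<open>Presburger arithmetic\<close>

text \<open>
  Constants, integer multiples \<open>k \<cdot> x\<close> etc. are not part of the syntax: they abbreviate
  terms built from \<open>0\<close>, \<open>1\<close>, \<open>-\<close> and \<open>+\<close>, so that the lengths below are those of the expanded
  (unary) form. Variables are \<open>v\<^sub>0, v\<^sub>1, \<dots>\<close>.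
\<close>

datatype tm = Var nat | Zero | One | Uminus tm | Plus tm tm

datatype rel = Eq | Neq | Less | Leq | Greater | Geq

datatype quant = Exists | Forall

datatype fm =
    Rel rel tm tm
  | Dvd nat tm
  | Neg fm
  | And fm fm
  | Or fm fm
  | Imp fm fm
  | Iff fm fm
  | Quant quant nat fm

text \<open>The predicates \<open>d | \<cdot>\<close> exist only for \<open>d \<ge> 2\<close>.\<close>

primrec wf_fm :: "fm \<Rightarrow> bool" where
  "wf_fm (Rel R s t) \<longleftrightarrow> True"
| "wf_fm (Dvd d t) \<longleftrightarrow> d \<ge> 2"
| "wf_fm (Neg \<phi>) \<longleftrightarrow> wf_fm \<phi>"
| "wf_fm (And \<phi> \<psi>) \<longleftrightarrow> wf_fm \<phi> \<and> wf_fm \<psi>"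
| "wf_fm (Or \<phi> \<psi>) \<longleftrightarrow> wf_fm \<phi> \<and> wf_fm \<psi>"
| "wf_fm (Imp \<phi> \<psi>) \<longleftrightarrow> wf_fm \<phi> \<and> wf_fm \<psi>"
| "wf_fm (Iff \<phi> \<psi>) \<longleftrightarrow> wf_fm \<phi> \<and> wf_fm \<psi>"
| "wf_fm (Quant Q x \<phi>) \<longleftrightarrow> wf_fm \<phi>"

primrec vars_tm :: "tm \<Rightarrow> nat set" where
  "vars_tm (Var x) = {x}"
| "vars_tm Zero = {}"
| "vars_tm One = {}"
| "vars_tm (Uminus t) = vars_tm t"
| "vars_tm (Plus s t) = vars_tm s \<union> vars_tm t"

primrec free_vars :: "fm \<Rightarrow> nat set" where
  "free_vars (Rel R s t) = vars_tm s \<union> vars_tm t"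
| "free_vars (Dvd d t) = vars_tm t"
| "free_vars (Neg \<phi>) = free_vars \<phi>"
| "free_vars (And \<phi> \<psi>) = free_vars \<phi> \<union> free_vars \<psi>"
| "free_vars (Or \<phi> \<psi>) = free_vars \<phi> \<union> free_vars \<psi>"
| "free_vars (Imp \<phi> \<psi>) = free_vars \<phi> \<union> free_vars \<psi>"
| "free_vars (Iff \<phi> \<psi>) = free_vars \<phi> \<union> free_vars \<psi>"
| "free_vars (Quant Q x \<phi>) = free_vars \<phi> - {x}"

primrec eval_tm :: "(nat \<Rightarrow> int) \<Rightarrow> tm \<Rightarrow> int" where
  "eval_tm \<sigma> (Var x) = \<sigma> x"
| "eval_tm \<sigma> Zero = 0"
| "eval_tm \<sigma> One = 1"
| "eval_tm \<sigma> (Uminus t) = - eval_tm \<sigma> t"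
| "eval_tm \<sigma> (Plus s t) = eval_tm \<sigma> s + eval_tm \<sigma> t"

primrec eval_rel :: "rel \<Rightarrow> int \<Rightarrow> int \<Rightarrow> bool" where
  "eval_rel Eq a b \<longleftrightarrow> a = b"
| "eval_rel Neq a b \<longleftrightarrow> a \<noteq> b"
| "eval_rel Less a b \<longleftrightarrow> a < b"
| "eval_rel Leq a b \<longleftrightarrow> a \<le> b"
| "eval_rel Greater a b \<longleftrightarrow> a > b"
| "eval_rel Geq a b \<longleftrightarrow> a \<ge> b"

primrec sat :: "(nat \<Rightarrow> int) \<Rightarrow> fm \<Rightarrow> bool" where
  "sat \<sigma> (Rel R s t) \<longleftrightarrow> eval_rel R (eval_tm \<sigma> s) (eval_tm \<sigma> t)"
| "sat \<sigma> (Dvd d t) \<longleftrightarrow> int d dvd eval_tm \<sigma> t"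
| "sat \<sigma> (Neg \<phi>) \<longleftrightarrow> \<not> sat \<sigma> \<phi>"
| "sat \<sigma> (And \<phi> \<psi>) \<longleftrightarrow> sat \<sigma> \<phi> \<and> sat \<sigma> \<psi>"
| "sat \<sigma> (Or \<phi> \<psi>) \<longleftrightarrow> sat \<sigma> \<phi> \<or> sat \<sigma> \<psi>"
| "sat \<sigma> (Imp \<phi> \<psi>) \<longleftrightarrow> (sat \<sigma> \<phi> \<longrightarrow> sat \<sigma> \<psi>)"
| "sat \<sigma> (Iff \<phi> \<psi>) \<longleftrightarrow> (sat \<sigma> \<phi> \<longleftrightarrow> sat \<sigma> \<psi>)"
| "sat \<sigma> (Quant Q x \<phi>) \<longleftrightarrow>
     (case Q of Exists \<Rightarrow> \<exists>a. sat (\<sigma>(x := a)) \<phi> | Forall \<Rightarrow> \<forall>a. sat (\<sigma>(x := a)) \<phi>)"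

text \<open>
  Integer tuples are lists. For a list \<open>xs = [x\<^sub>1, \<dots>, x\<^sub>r]\<close> of distinct variables containing
  the free variables of \<open>\<phi>\<close>, this is the set of all \<open>[a\<^sub>1, \<dots>, a\<^sub>r]\<close> such that \<open>\<phi>\<close> holds when
  each \<open>x\<^sub>i\<close> is assigned \<open>a\<^sub>i\<close>. The values given to variables outside \<open>xs\<close> are irrelevant.
\<close>

definition defined_set :: "nat list \<Rightarrow> fm \<Rightarrow> int list set" where
  "defined_set xs \<phi> =
     {as. length as = length xs \<and> sat (\<lambda>x. the (map_of (zip xs as) x)) \<phi>}"


section \<open>Complexity measures of formulas\<close>

text \<open>
  Every symbol and every variable occurrence is one letter, except that \<open>d | t\<close> costs \<open>d + 1\<close>
  letters in addition to those of \<open>t\<close>. Parentheses are not counted; counting them could only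
  enlarge the length.
\<close>

primrec len_tm :: "tm \<Rightarrow> nat" where
  "len_tm (Var x) = 1"
| "len_tm Zero = 1"
| "len_tm One = 1"
| "len_tm (Uminus t) = 1 + len_tm t"
| "len_tm (Plus s t) = len_tm s + 1 + len_tm t"

primrec len :: "fm \<Rightarrow> nat" where
  "len (Rel R s t) = len_tm s + 1 + len_tm t"
| "len (Dvd d t) = len_tm t + d + 1"
| "len (Neg \<phi>) = 1 + len \<phi>"
| "len (And \<phi> \<psi>) = len \<phi> + 1 + len \<psi>"
| "len (Or \<phi> \<psi>) = len \<phi> + 1 + len \<psi>"
| "len (Imp \<phi> \<psi>) = len \<phi> + 1 + len \<psi>"
| "len (Iff \<phi> \<psi>) = len \<phi> + 1 + len \<psi>"
| "len (Quant Q x \<phi>) = 2 + len \<phi>"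

primrec dual :: "quant \<Rightarrow> quant" where
  "dual Exists = Forall"
| "dual Forall = Exists"

text \<open>
  In \<open>qa_q\<close> and \<open>qbl_q\<close> the clauses for implication and equivalence are obtained by rewriting
  \<open>\<phi> \<rightarrow> \<psi>\<close> to \<open>\<not> \<phi> \<or> \<psi>\<close> and \<open>\<phi> \<leftrightarrow> \<psi>\<close> to \<open>(\<phi> \<rightarrow> \<psi>) \<and> (\<psi> \<rightarrow> \<phi>)\<close>; see the lemmas following
  each definition.
\<close>

primrec qa_q :: "quant \<Rightarrow> fm \<Rightarrow> nat" where
  "qa_q Q (Rel R s t) = 0"
| "qa_q Q (Dvd d t) = 0"
| "qa_q Q (Neg \<phi>) = qa_q (dual Q) \<phi>"
| "qa_q Q (And \<phi> \<psi>) = max (qa_q Q \<phi>) (qa_q Q \<psi>)"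
| "qa_q Q (Or \<phi> \<psi>) = max (qa_q Q \<phi>) (qa_q Q \<psi>)"
| "qa_q Q (Imp \<phi> \<psi>) = max (qa_q (dual Q) \<phi>) (qa_q Q \<psi>)"
| "qa_q Q (Iff \<phi> \<psi>) =
     max (max (qa_q (dual Q) \<phi>) (qa_q Q \<psi>)) (max (qa_q (dual Q) \<psi>) (qa_q Q \<phi>))"
| "qa_q Q (Quant P x \<phi>) =
     (if P = Q then max 1 (qa_q Q \<phi>) else 1 + qa_q (dual Q) \<phi>)"

lemma qa_q_Imp_rewrite: "qa_q Q (Imp \<phi> \<psi>) = qa_q Q (Or (Neg \<phi>) \<psi>)"
  by simp

lemma qa_q_Iff_rewrite: "qa_q Q (Iff \<phi> \<psi>) = qa_q Q (And (Imp \<phi> \<psi>) (Imp \<psi> \<phi>))"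
  by simp

definition qa :: "fm \<Rightarrow> nat" where
  "qa \<phi> = min (qa_q Exists \<phi>) (qa_q Forall \<phi>)"

primrec qbl_q :: "quant \<Rightarrow> fm \<Rightarrow> nat" where
  "qbl_q Q (Rel R s t) = 0"
| "qbl_q Q (Dvd d t) = 0"
| "qbl_q Q (Neg \<phi>) = qbl_q (dual Q) \<phi>"
| "qbl_q Q (And \<phi> \<psi>) = qbl_q Q \<phi> + qbl_q Q \<psi>"
| "qbl_q Q (Or \<phi> \<psi>) = qbl_q Q \<phi> + qbl_q Q \<psi>"
| "qbl_q Q (Imp \<phi> \<psi>) = qbl_q (dual Q) \<phi> + qbl_q Q \<psi>"
| "qbl_q Q (Iff \<phi> \<psi>) =
     (qbl_q (dual Q) \<phi> + qbl_q Q \<psi>) + (qbl_q (dual Q) \<psi> + qbl_q Q \<phi>)"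
| "qbl_q Q (Quant P x \<phi>) = (if P = Q then 1 + qbl_q Q \<phi> else 0)"

lemma qbl_q_Imp_rewrite: "qbl_q Q (Imp \<phi> \<psi>) = qbl_q Q (Or (Neg \<phi>) \<psi>)"
  by simp

lemma qbl_q_Iff_rewrite: "qbl_q Q (Iff \<phi> \<psi>) = qbl_q Q (And (Imp \<phi> \<psi>) (Imp \<psi> \<phi>))"
  by simp

primrec subformulas :: "fm \<Rightarrow> fm set" where
  "subformulas (Rel R s t) = {Rel R s t}"
| "subformulas (Dvd d t) = {Dvd d t}"
| "subformulas (Neg \<phi>) = insert (Neg \<phi>) (subformulas \<phi>)"
| "subformulas (And \<phi> \<psi>) = insert (And \<phi> \<psi>) (subformulas \<phi> \<union> subformulas \<psi>)"
| "subformulas (Or \<phi> \<psi>) = insert (Or \<phi> \<psi>) (subformulas \<phi> \<union> subformulas \<psi>)"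
| "subformulas (Imp \<phi> \<psi>) = insert (Imp \<phi> \<psi>) (subformulas \<phi> \<union> subformulas \<psi>)"
| "subformulas (Iff \<phi> \<psi>) = insert (Iff \<phi> \<psi>) (subformulas \<phi> \<union> subformulas \<psi>)"
| "subformulas (Quant Q x \<phi>) = insert (Quant Q x \<phi>) (subformulas \<phi>)"

lemma finite_subformulas: "finite (subformulas \<phi>)"
  by (induction \<phi>) auto

definition qbl :: "fm \<Rightarrow> nat" where
  "qbl \<phi> = Max (\<Union>\<psi>\<in>subformulas \<phi>. {qbl_q Exists \<psi>, qbl_q Forall \<psi>})"


section \<open>Deterministic word automata\<close>

text \<open>The field \<open>trans\<close> is only relevant on states and on letters of the alphabet at hand.\<close>

record ('s, 'a) dwa =
  states :: "'s set"
  init :: 's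
  trans :: "'s \<Rightarrow> 'a \<Rightarrow> 's"
  final :: "'s set"

definition is_dwa :: "'a set \<Rightarrow> ('s, 'a) dwa \<Rightarrow> bool" where
  "is_dwa \<Sigma> A \<longleftrightarrow>
     finite (states A) \<and> init A \<in> states A \<and> final A \<subseteq> states A \<and>
     (\<forall>q\<in>states A. \<forall>a\<in>\<Sigma>. trans A q a \<in> states A)"

definition language :: "'a set \<Rightarrow> ('s, 'a) dwa \<Rightarrow> 'a list set" where
  "language \<Sigma> A = {w \<in> lists \<Sigma>. foldl (trans A) (init A) w \<in> final A}"


section \<open>Encoding of integer tuples\<close>

text \<open>Digit words are lists with the most significant digit first.\<close>

definition decode_nat :: "nat \<Rightarrow> nat list \<Rightarrow> nat" where
  "decode_nat \<rho> bs = (\<Sum>i<length bs. \<rho> ^ i * rev bs ! i)"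

text \<open>Only nonempty words encode integers; \<open>[]\<close> gets a dummy value that is never used.\<close>

fun decode_int :: "nat \<Rightarrow> nat list \<Rightarrow> int" where
  "decode_int \<rho> [] = 0"
| "decode_int \<rho> (b # bs) =
     (if b = 0 then int (decode_nat \<rho> bs)
      else int (decode_nat \<rho> bs) - int \<rho> ^ length bs)"

text \<open>A letter of \<open>\<Sigma>\<^sup>r\<close> is a list of \<open>r\<close> digits, one for each track.\<close>

definition alphabet :: "nat \<Rightarrow> nat \<Rightarrow> nat list set" where
  "alphabet \<rho> r = {a. length a = r \<and> set a \<subseteq> {..<\<rho>}}"

definition decode :: "nat \<Rightarrow> nat \<Rightarrow> nat list list \<Rightarrow> int list" where
  "decode \<rho> r w = map (\<lambda>i. decode_int \<rho> (map (\<lambda>a. a ! i) w)) [0..<r]"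

definition represents :: "nat \<Rightarrow> nat \<Rightarrow> ('s, nat list) dwa \<Rightarrow> int list set \<Rightarrow> bool" where
  "represents \<rho> r A U \<longleftrightarrow>
     is_dwa (alphabet \<rho> r) A \<and>
     language (alphabet \<rho> r) A = {w \<in> lists (alphabet \<rho> r). w \<noteq> [] \<and> decode \<rho> r w \<in> U}"

text \<open>
  Since automata are finite, it is no restriction to take natural numbers as states when
  comparing the sizes of all automata that represent \<open>U\<close>.
\<close>

definition minimal_dwa :: "nat \<Rightarrow> nat \<Rightarrow> (nat, nat list) dwa \<Rightarrow> int list set \<Rightarrow> bool" where
  "minimal_dwa \<rho> r A U \<longleftrightarrow>
     represents \<rho> r A U \<and>
     (\<forall>B :: (nat, nat list) dwa. represents \<rho> r B U \<longrightarrow> card (states A) \<le> card (states B))"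

end

(*
  Call two assignments similar if a finite set F of homogeneous linear forms takes the same values
  on them, up to clipping at some constant C, and if they agree modulo some D. Every formula defines
  a union of similarity classes, and reading one more digit respects similarity as soon as C is at
  least the norm of the forms. Hence the classes are the states of an automaton, whose number
  (2C+1)^|F| * D^r does not depend on the base.

  It remains to bound |F|, log C and log D. Quantified variables are eliminated in blocks. A witness
  may be moved so that some form in F, the pivot, takes a small value; solving for the variable
  replaces the other forms by their combinations with the pivot. Each path through the choices of
  pivots for k variables ends with at most |F| forms, so a block turns |F| into at most |F|^(k+1)
  instead of the |F|^(2^k) of an elimination one variable at a time. The coefficients are roughly
  squared in every step, but only their logarithms matter.
*)

theory Submission
  imports Defs "HOL-Library.Nat_Bijection"
begin

section \<open>Automata from digit-stable classifiers\<close>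

text \<open>One number \<open>G\<close> bounds both |F| and the logarithms of C, D and the
  coefficients; the logarithm of the number of states is then of order \<open>G * G\<close>. The
  forms are homogeneous because constant terms can be absorbed by C, so the choice of a pivot never
  branches over its possible offsets. The price is that the value of the pivot has to be reproduced
  exactly, which multiplies D by the coefficient of the pivot. Which pivot occurs depends on the
  assignment, so D must be a common multiple over all paths, and log D grows by a factor |F| per
  variable. The obstacle between blocks is negation: a set given with an open block is a projection,
  and only after elimination is it a union of similarity classes, hence closed under complement.
  Every formula is therefore treated in both polarities, a universal block being an existential
  block of the complement, and elimination happens exactly where \<open>qa_q\<close> counts an
  alternation. Quantifier-free formulas need their own count: for them the claimed bound is just
  \<open>2 ^ n\<close>, below what the general estimate gives.\<close>

lemma decode_nat_snoc: "decode_nat \<rho> (bs @ [b]) = \<rho> * decode_nat \<rho> bs + b"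
  unfolding decode_nat_def
  by (simp add: sum.lessThan_Suc_shift sum_distrib_left mult.assoc del: sum.lessThan_Suc)

text \<open>The sign digit stays in front, so its contribution \<open>- \<rho> ^ n\<close> is scaled
  by \<open>\<rho>\<close> like the rest. The empty word is excluded because a letter appended to it
  is itself the sign digit.\<close>

lemma decode_int_snoc:
  assumes "bs \<noteq> []"
  shows "decode_int \<rho> (bs @ [b]) = int \<rho> * decode_int \<rho> bs + int b"
  using assms by (cases bs) (auto simp: decode_nat_snoc algebra_simps)

text \<open>Reading the digit \<open>\<beta> x\<close> on the track of \<open>x\<close> turns the value \<open>\<sigma> x\<close> into \<open>\<rho> * \<sigma> x + \<beta> x\<close>.\<close>

definition digit_stable :: "nat \<Rightarrow> nat \<Rightarrow> ((nat \<Rightarrow> int) \<Rightarrow> nat) \<Rightarrow> bool" where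
  "digit_stable \<rho> S \<kappa> \<longleftrightarrow> finite (range \<kappa>) \<and> card (range \<kappa>) \<le> S \<and>
     (\<forall>\<sigma> \<sigma>' \<beta>. \<kappa> \<sigma> = \<kappa> \<sigma>' \<longrightarrow> (\<forall>x. 0 \<le> \<beta> x \<and> \<beta> x < int \<rho>) \<longrightarrow>
       \<kappa> (\<lambda>x. int \<rho> * \<sigma> x + \<beta> x) = \<kappa> (\<lambda>x. int \<rho> * \<sigma>' x + \<beta> x))"

lemma digit_stableI:
  assumes "finite (range \<kappa>)" "card (range \<kappa>) \<le> S"
    "\<And>\<sigma> \<sigma>' \<beta>. \<kappa> \<sigma> = \<kappa> \<sigma>' \<Longrightarrow> (\<And>x. 0 \<le> \<beta> x \<and> \<beta> x < int \<rho>) \<Longrightarrow>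
      \<kappa> (\<lambda>x. int \<rho> * \<sigma> x + \<beta> x) = \<kappa> (\<lambda>x. int \<rho> * \<sigma>' x + \<beta> x)"
  shows "digit_stable \<rho> S \<kappa>"
  using assms unfolding digit_stable_def by blast

lemma digit_stableD:
  assumes "digit_stable \<rho> S \<kappa>"
  shows "finite (range \<kappa>)" "card (range \<kappa>) \<le> S"
    "\<kappa> \<sigma> = \<kappa> \<sigma>' \<Longrightarrow> (\<And>x. 0 \<le> \<beta> x \<and> \<beta> x < int \<rho>) \<Longrightarrow>
      \<kappa> (\<lambda>x. int \<rho> * \<sigma> x + \<beta> x) = \<kappa> (\<lambda>x. int \<rho> * \<sigma>' x + \<beta> x)"
  using assms unfolding digit_stable_def by blast+

text \<open>The default 0 is a fixed point of reading the digit 0, so a step of the automaton is the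
  update \<open>\<rho> * \<sigma> x + \<beta> x\<close> for all variables at once, with a legal
  digit also outside \<open>xs\<close>.\<close>

definition assignment :: "nat list \<Rightarrow> int list \<Rightarrow> nat \<Rightarrow> int" where
  "assignment xs as = (\<lambda>x. if x \<in> set xs then the (map_of (zip xs as) x) else 0)"

lemma assignment_nth:
  assumes "distinct xs" "length as = length xs" "i < length xs"
  shows "assignment xs as (xs ! i) = as ! i"
  using assms by (simp add: assignment_def map_of_zip_nth)

lemma assignment_snoc:
  assumes "distinct xs" "w \<noteq> []"
  shows "assignment xs (decode \<rho> (length xs) (w @ [a])) =
    (\<lambda>x. int \<rho> * assignment xs (decode \<rho> (length xs) w) x + assignment xs (map (\<lambda>i. int (a ! i)) [0..<length xs]) x)"
proof
  fix x
  show "assignment xs (decode \<rho> (length xs) (w @ [a])) x =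
    int \<rho> * assignment xs (decode \<rho> (length xs) w) x + assignment xs (map (\<lambda>i. int (a ! i)) [0..<length xs]) x"
  proof (cases "x \<in> set xs")
    case True
    then obtain i where i: "i < length xs" "x = xs ! i" by (auto simp: in_set_conv_nth)
    have "decode_int \<rho> (map (\<lambda>a. a ! i) w @ [a ! i]) = int \<rho> * decode_int \<rho> (map (\<lambda>a. a ! i) w) + int (a ! i)"
      using assms by (intro decode_int_snoc) auto
    then show ?thesis
      using i assms by (simp add: assignment_nth decode_def)
  qed (simp add: assignment_def)
qed

text \<open>State \<open>Suc c\<close> stands for the class \<open>c\<close>. State 0 is a separate
  start state, since the empty word encodes nothing and the first letter is read as a sign; this is
  the \<open>+ 1\<close>. A transition applies the digit update to an arbitrary representative of
  the class, and digit stability makes the result independent of that choice.\<close>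

lemma dwa_of_digit_stable:
  assumes \<kappa>: "digit_stable \<rho> S \<kappa>" and U: "\<And>\<sigma> \<sigma>'. \<kappa> \<sigma> = \<kappa> \<sigma>' \<Longrightarrow> U \<sigma> \<longleftrightarrow> U \<sigma>'"
    and xs: "distinct xs" and "\<rho> > 0"
  shows "\<exists>A :: (nat, nat list) dwa. represents \<rho> (length xs) A {as. length as = length xs \<and> U (assignment xs as)} \<and> card (states A) \<le> S + 1"
proof -
  let ?r = "length xs" and ?pick = "\<lambda>q. SOME \<sigma>. \<kappa> \<sigma> = q - Suc 0"
  define A where "A = \<lparr>states = insert 0 (Suc ` range \<kappa>), init = 0,
    trans = (\<lambda>q a. if q = 0 then Suc (\<kappa> (assignment xs (decode \<rho> ?r [a])))
      else Suc (\<kappa> (\<lambda>x. int \<rho> * ?pick q x + assignment xs (map (\<lambda>i. int (a ! i)) [0..<?r]) x))),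
    final = {Suc (\<kappa> \<sigma>) |\<sigma>. U \<sigma>}\<rparr>"
  have dwa: "is_dwa (alphabet \<rho> ?r) A"
    using digit_stableD(1)[OF \<kappa>] by (auto simp: is_dwa_def A_def)
  have run: "w \<in> lists (alphabet \<rho> ?r) \<Longrightarrow> w \<noteq> [] \<Longrightarrow>
      foldl (trans A) (init A) w = Suc (\<kappa> (assignment xs (decode \<rho> ?r w)))" for w
  proof (induction w rule: rev_induct)
    case (snoc a w)
    show ?case
    proof (cases "w = []")
      case True
      then show ?thesis by (simp add: A_def)
    next
      case False
      define \<beta> where "\<beta> = assignment xs (map (\<lambda>i. int (a ! i)) [0..<?r])"
      define \<tau> where "\<tau> = ?pick (Suc (\<kappa> (assignment xs (decode \<rho> ?r w))))"
      have a: "length a = ?r" "set a \<subseteq> {..<\<rho>}"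
        using snoc.prems by (auto simp: alphabet_def)
      have \<beta>: "0 \<le> \<beta> x \<and> \<beta> x < int \<rho>" for x
      proof (cases "x \<in> set xs")
        case True
        then obtain i where i: "i < ?r" "x = xs ! i" by (auto simp: in_set_conv_nth)
        then have "a ! i \<in> set a" using a by auto
        then have "a ! i < \<rho>" using a(2) by blast
        then show ?thesis using i xs by (simp add: \<beta>_def assignment_nth)
      qed (use \<open>\<rho> > 0\<close> in \<open>simp add: \<beta>_def assignment_def\<close>)
      have "\<kappa> \<tau> = \<kappa> (assignment xs (decode \<rho> ?r w))"
        unfolding \<tau>_def by (rule someI2[of _ "assignment xs (decode \<rho> ?r w)"]) auto
      then have "\<kappa> (\<lambda>x. int \<rho> * \<tau> x + \<beta> x) = \<kappa> (\<lambda>x. int \<rho> * assignment xs (decode \<rho> ?r w) x + \<beta> x)"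
        using \<beta> by (rule digit_stableD(3)[OF \<kappa>])
      moreover have "foldl (trans A) (init A) w = Suc (\<kappa> (assignment xs (decode \<rho> ?r w)))"
        using snoc False by simp
      then have "foldl (trans A) (init A) (w @ [a]) = Suc (\<kappa> (\<lambda>x. int \<rho> * \<tau> x + \<beta> x))"
        by (simp add: A_def \<tau>_def \<beta>_def)
      ultimately show ?thesis
        by (simp only: assignment_snoc[OF xs False] \<beta>_def)
    qed
  qed simp
  have "language (alphabet \<rho> ?r) A = {w \<in> lists (alphabet \<rho> ?r). w \<noteq> [] \<and>
      decode \<rho> ?r w \<in> {as. length as = ?r \<and> U (assignment xs as)}}" (is "_ = ?L")
  proof (intro set_eqI)
    fix w
    show "w \<in> language (alphabet \<rho> ?r) A \<longleftrightarrow> w \<in> ?L"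
    proof (cases "w \<in> lists (alphabet \<rho> ?r) \<and> w \<noteq> []")
      case True
      have "Suc (\<kappa> \<sigma>) \<in> final A \<longleftrightarrow> U \<sigma>" for \<sigma>
        unfolding A_def by (simp, metis U)
      then show ?thesis
        using True run[of w] by (simp add: language_def decode_def)
    qed (auto simp: language_def A_def)
  qed
  then have "represents \<rho> ?r A {as. length as = ?r \<and> U (assignment xs as)}"
    using dwa by (simp add: represents_def)
  moreover have "card (states A) \<le> S + 1"
  proof -
    have "card (states A) \<le> Suc (card (Suc ` range \<kappa>))"
      using digit_stableD(1)[OF \<kappa>] by (simp add: A_def card_insert_if)
    also have "\<dots> \<le> S + 1"
      using digit_stableD(2)[OF \<kappa>] by (simp add: card_image)
    finally show ?thesis .
  qed
  ultimately show ?thesis by blast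
qed

text \<open>Existence is stated along with the bound so that the bound is not vacuous.\<close>

lemma minimal_dwa_bound:
  assumes "represents \<rho> r (A :: (nat, nat list) dwa) U" "card (states A) \<le> K"
  shows "(\<exists>A. minimal_dwa \<rho> r A U) \<and> (\<forall>A. minimal_dwa \<rho> r A U \<longrightarrow> card (states A) \<le> K)"
proof
  let ?P = "\<lambda>A :: (nat, nat list) dwa. represents \<rho> r A U"
  have "?P (arg_min (card \<circ> states) ?P) \<and> (\<forall>B. ?P B \<longrightarrow> (card \<circ> states) (arg_min (card \<circ> states) ?P) \<le> (card \<circ> states) B)"
    by (rule arg_min_nat_lemma) (rule assms(1))
  then show "\<exists>A. minimal_dwa \<rho> r A U"
    by (auto simp: minimal_dwa_def)
  show "\<forall>A. minimal_dwa \<rho> r A U \<longrightarrow> card (states A) \<le> K"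
    using assms by (auto simp: minimal_dwa_def intro: order_trans)
qed

section \<open>Products of classifiers\<close>

lemma digit_stable_mono: "digit_stable \<rho> S \<kappa> \<Longrightarrow> S \<le> T \<Longrightarrow> digit_stable \<rho> T \<kappa>"
  unfolding digit_stable_def using order_trans by blast

lemma digit_stable_const: "digit_stable \<rho> 1 (\<lambda>_. 0)"
  by (simp add: digit_stable_def)

text \<open>The product construction. Classes are natural numbers to match the states of the
  automata, hence \<open>prod_encode\<close>.\<close>

lemma digit_stable_pair:
  assumes "digit_stable \<rho> S \<kappa>" "digit_stable \<rho> T \<mu>"
  shows "digit_stable \<rho> (S * T) (\<lambda>\<sigma>. prod_encode (\<kappa> \<sigma>, \<mu> \<sigma>))"
proof -
  have sub: "range (\<lambda>\<sigma>. prod_encode (\<kappa> \<sigma>, \<mu> \<sigma>)) \<subseteq> prod_encode ` (range \<kappa> \<times> range \<mu>)"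
    by auto
  have fin: "finite (prod_encode ` (range \<kappa> \<times> range \<mu>))"
    using assms by (simp add: digit_stableD(1))
  have "card (range (\<lambda>\<sigma>. prod_encode (\<kappa> \<sigma>, \<mu> \<sigma>))) \<le> card (prod_encode ` (range \<kappa> \<times> range \<mu>))"
    by (rule card_mono[OF fin sub])
  also have "\<dots> \<le> card (range \<kappa> \<times> range \<mu>)"
    using assms by (intro card_image_le) (simp add: digit_stableD(1))
  also have "\<dots> \<le> S * T"
    using assms by (simp add: card_cartesian_product digit_stableD(2) mult_le_mono)
  finally show ?thesis
  proof (intro digit_stableI)
    show "finite (range (\<lambda>\<sigma>. prod_encode (\<kappa> \<sigma>, \<mu> \<sigma>)))"
      by (rule finite_subset[OF sub fin])
  next
    fix \<sigma> \<sigma>' \<beta> :: "nat \<Rightarrow> int"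
    assume "prod_encode (\<kappa> \<sigma>, \<mu> \<sigma>) = prod_encode (\<kappa> \<sigma>', \<mu> \<sigma>')" and \<beta>: "\<And>x. 0 \<le> \<beta> x \<and> \<beta> x < int \<rho>"
    then have "\<kappa> \<sigma> = \<kappa> \<sigma>'" "\<mu> \<sigma> = \<mu> \<sigma>'" by simp_all
    then have "\<kappa> (\<lambda>x. int \<rho> * \<sigma> x + \<beta> x) = \<kappa> (\<lambda>x. int \<rho> * \<sigma>' x + \<beta> x)"
      "\<mu> (\<lambda>x. int \<rho> * \<sigma> x + \<beta> x) = \<mu> (\<lambda>x. int \<rho> * \<sigma>' x + \<beta> x)"
      using \<beta> by (auto intro: digit_stableD(3)[OF assms(1)] digit_stableD(3)[OF assms(2)])
    then show "prod_encode (\<kappa> (\<lambda>x. int \<rho> * \<sigma> x + \<beta> x), \<mu> (\<lambda>x. int \<rho> * \<sigma> x + \<beta> x)) =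
        prod_encode (\<kappa> (\<lambda>x. int \<rho> * \<sigma>' x + \<beta> x), \<mu> (\<lambda>x. int \<rho> * \<sigma>' x + \<beta> x))"
      by argo
  qed
qed

lemma digit_stable_family:
  assumes "finite I" "\<And>i. i \<in> I \<Longrightarrow> digit_stable \<rho> S (\<kappa> i)"
  shows "\<exists>\<mu>. digit_stable \<rho> (S ^ card I) \<mu> \<and> (\<forall>\<sigma> \<sigma>'. \<mu> \<sigma> = \<mu> \<sigma>' \<longrightarrow> (\<forall>i\<in>I. \<kappa> i \<sigma> = \<kappa> i \<sigma>'))"
  using assms
proof (induction I rule: finite_induct)
  case empty
  then show ?case using digit_stable_const by auto
next
  case (insert i I)
  then obtain \<mu> where \<mu>: "digit_stable \<rho> (S ^ card I) \<mu>" "\<forall>\<sigma> \<sigma>'. \<mu> \<sigma> = \<mu> \<sigma>' \<longrightarrow> (\<forall>i\<in>I. \<kappa> i \<sigma> = \<kappa> i \<sigma>')"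
    by blast
  have "digit_stable \<rho> (S * S ^ card I) (\<lambda>\<sigma>. prod_encode (\<kappa> i \<sigma>, \<mu> \<sigma>))"
    by (rule digit_stable_pair[OF insert.prems \<mu>(1)]) simp
  then have "digit_stable \<rho> (S ^ card (insert i I)) (\<lambda>\<sigma>. prod_encode (\<kappa> i \<sigma>, \<mu> \<sigma>))"
    using insert.hyps by simp
  moreover have "\<kappa> j \<sigma> = \<kappa> j \<sigma>'"
    if "prod_encode (\<kappa> i \<sigma>, \<mu> \<sigma>) = prod_encode (\<kappa> i \<sigma>', \<mu> \<sigma>')" "j \<in> insert i I" for \<sigma> \<sigma>' j
  proof (cases "j = i")
    case False
    have "\<mu> \<sigma> = \<mu> \<sigma>'" using that(1) by simp
    then show ?thesis using that(2) False \<mu>(2) by blast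
  qed (use that in simp)
  ultimately show ?case
    by blast
qed

section \<open>Clipped values and residues of linear forms\<close>

definition clip :: "int \<Rightarrow> int \<Rightarrow> int" where
  "clip C v = max (- C) (min C v)"

lemma clip_eq_iff:
  assumes "0 < C"
  shows "clip C u = clip C v \<longleftrightarrow> u = v \<or> C \<le> u \<and> C \<le> v \<or> u \<le> - C \<and> v \<le> - C"
  using assms unfolding clip_def by (auto simp: max_def min_def)

lemma clip_eq_mono:
  assumes "clip C u = clip C v" "0 < B" "B \<le> C"
  shows "clip B u = clip B v"
  using assms by (auto simp: clip_eq_iff)

text \<open>Saturation persists: from \<open>C \<le> u\<close> follows
  \<open>\<rho> * u + e \<ge> \<rho> * C - (\<rho> - 1) * C = C\<close>, and symmetrically below.
  The bound \<open>(\<rho> - 1) * C\<close> on \<open>e\<close> is what digits below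
  \<open>\<rho>\<close> contribute to a form of norm at most \<open>C\<close>, which is why
  \<open>C\<close> need not depend on the base.\<close>

lemma clip_digit:
  assumes "clip C u = clip C v" "\<bar>e\<bar> \<le> (\<rho> - 1) * C" "0 < C" "1 \<le> \<rho>"
  shows "clip C (\<rho> * u + e) = clip C (\<rho> * v + e)"
proof -
  have up: "C \<le> \<rho> * u + e" if "C \<le> u" for u
  proof -
    have "\<rho> * C \<le> \<rho> * u" using that assms(4) by (intro mult_left_mono) auto
    then show ?thesis using assms(2) by (auto simp: left_diff_distrib)
  qed
  have lo: "\<rho> * u + e \<le> - C" if "u \<le> - C" for u
  proof -
    have "\<rho> * u \<le> \<rho> * (- C)" using that assms(4) by (intro mult_left_mono) auto
    then show ?thesis using assms(2) by (auto simp: left_diff_distrib)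
  qed
  show ?thesis
    using assms(1) up lo unfolding clip_eq_iff[OF assms(3)] by blast
qed

lemma lin_digit:
  fixes \<sigma> \<beta> :: "nat \<Rightarrow> int"
  shows "(\<Sum>x\<in>X. f x * (\<rho> * \<sigma> x + \<beta> x)) = \<rho> * (\<Sum>x\<in>X. f x * \<sigma> x) + (\<Sum>x\<in>X. f x * \<beta> x)"
  by (simp add: sum.distrib sum_distrib_left algebra_simps)

lemma digit_stable_clip:
  assumes "(\<Sum>x\<in>X. \<bar>f x\<bar>) \<le> int C" "C > 0" "\<rho> > 0"
  shows "digit_stable \<rho> (2 * C + 1) (\<lambda>\<sigma>. nat (clip (int C) (\<Sum>x\<in>X. f x * \<sigma> x) + int C))"
proof -
  let ?\<kappa> = "\<lambda>\<sigma>. nat (clip (int C) (\<Sum>x\<in>X. f x * \<sigma> x) + int C)"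
  have sub: "range ?\<kappa> \<subseteq> {..2 * C}"
    by (auto simp: clip_def)
  then have "finite (range ?\<kappa>)" "card (range ?\<kappa>) \<le> 2 * C + 1"
    using finite_subset card_mono[OF _ sub] by auto
  moreover have "?\<kappa> (\<lambda>x. int \<rho> * \<sigma> x + \<beta> x) = ?\<kappa> (\<lambda>x. int \<rho> * \<sigma>' x + \<beta> x)"
    if "?\<kappa> \<sigma> = ?\<kappa> \<sigma>'" and \<beta>: "\<And>x. 0 \<le> \<beta> x \<and> \<beta> x < int \<rho>" for \<sigma> \<sigma>' \<beta>
  proof -
    have "clip (int C) (\<Sum>x\<in>X. f x * \<sigma> x) = clip (int C) (\<Sum>x\<in>X. f x * \<sigma>' x)"
      using that(1) by (simp add: clip_def eq_nat_nat_iff)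
    moreover have "\<bar>\<Sum>x\<in>X. f x * \<beta> x\<bar> \<le> (int \<rho> - 1) * int C"
    proof -
      have "\<bar>\<Sum>x\<in>X. f x * \<beta> x\<bar> \<le> (\<Sum>x\<in>X. \<bar>f x\<bar> * (int \<rho> - 1))"
        by (rule order_trans[OF sum_abs]) (use \<beta> in \<open>auto simp: abs_mult intro!: sum_mono mult_left_mono\<close>)
      also have "\<dots> = (int \<rho> - 1) * (\<Sum>x\<in>X. \<bar>f x\<bar>)"
        by (simp add: sum_distrib_left mult.commute)
      also have "\<dots> \<le> (int \<rho> - 1) * int C"
        using assms by (intro mult_left_mono) auto
      finally show ?thesis .
    qed
    ultimately have "clip (int C) (int \<rho> * (\<Sum>x\<in>X. f x * \<sigma> x) + (\<Sum>x\<in>X. f x * \<beta> x)) =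
        clip (int C) (int \<rho> * (\<Sum>x\<in>X. f x * \<sigma>' x) + (\<Sum>x\<in>X. f x * \<beta> x))"
      by (rule clip_digit) (use assms(2,3) in auto)
    then show ?thesis
      by (simp only: lin_digit)
  qed
  ultimately show ?thesis
    by (rule digit_stableI)
qed

lemma digit_stable_mod:
  assumes "D > 0"
  shows "digit_stable \<rho> D (\<lambda>\<sigma>. nat ((\<Sum>x\<in>X. f x * \<sigma> x) mod int D))"
proof -
  let ?\<kappa> = "\<lambda>\<sigma>. nat ((\<Sum>x\<in>X. f x * \<sigma> x) mod int D)"
  have sub: "range ?\<kappa> \<subseteq> {..<D}"
    using assms by (simp add: image_subset_iff nat_less_iff)
  then have "finite (range ?\<kappa>)" "card (range ?\<kappa>) \<le> D"
    using finite_subset card_mono[OF _ sub] by auto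
  moreover have "?\<kappa> (\<lambda>x. int \<rho> * \<sigma> x + \<beta> x) = ?\<kappa> (\<lambda>x. int \<rho> * \<sigma>' x + \<beta> x)"
    if "?\<kappa> \<sigma> = ?\<kappa> \<sigma>'" for \<sigma> \<sigma>' \<beta>
  proof -
    have "(\<Sum>x\<in>X. f x * \<sigma> x) mod int D = (\<Sum>x\<in>X. f x * \<sigma>' x) mod int D"
      using that assms by (simp add: eq_nat_nat_iff)
    then show ?thesis
      unfolding lin_digit by (intro arg_cong[of _ _ nat] mod_add_cong mod_mult_cong) simp_all
  qed
  ultimately show ?thesis
    by (rule digit_stableI)
qed

section \<open>Elimination of a block of existential quantifiers\<close>

text \<open>
  A pair \<open>(f, g)\<close> is the homogeneous linear form with coefficients \<open>f\<close> on the parameters \<open>\<sigma>\<close>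
  and \<open>g\<close> on the block variables \<open>\<tau>\<close>.
\<close>

type_synonym form = "(nat \<Rightarrow> int) \<times> (nat \<Rightarrow> int)"

definition val :: "nat set \<Rightarrow> nat \<Rightarrow> form \<Rightarrow> (nat \<Rightarrow> int) \<Rightarrow> (nat \<Rightarrow> int) \<Rightarrow> int" where
  "val X k p \<sigma> \<tau> = (\<Sum>x\<in>X. fst p x * \<sigma> x) + (\<Sum>j<k. snd p j * \<tau> j)"

definition bounded_by :: "nat set \<Rightarrow> nat \<Rightarrow> int \<Rightarrow> form \<Rightarrow> bool" where
  "bounded_by X k A p \<longleftrightarrow> (\<forall>x\<in>X. \<bar>fst p x\<bar> \<le> A) \<and> (\<forall>j<k. \<bar>snd p j\<bar> \<le> A)"

text \<open>Congruence is imposed on the variables rather than on the values of the forms; it then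
  passes to every linear form, in particular to pivots that arise only later.\<close>

definition similar :: "nat set \<Rightarrow> nat \<Rightarrow> form set \<Rightarrow> int \<Rightarrow> int \<Rightarrow>
    (nat \<Rightarrow> int) \<Rightarrow> (nat \<Rightarrow> int) \<Rightarrow> (nat \<Rightarrow> int) \<Rightarrow> (nat \<Rightarrow> int) \<Rightarrow> bool" where
  "similar X k F C D \<sigma> \<tau> \<sigma>' \<tau>' \<longleftrightarrow>
     (\<forall>p\<in>F. clip C (val X k p \<sigma> \<tau>) = clip C (val X k p \<sigma>' \<tau>')) \<and>
     (\<forall>x\<in>X. D dvd \<sigma>' x - \<sigma> x) \<and> (\<forall>j<k. D dvd \<tau>' j - \<tau> j)"

lemma bounded_by_mono: "bounded_by X k A p \<Longrightarrow> A \<le> B \<Longrightarrow> bounded_by X k B p"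
  unfolding bounded_by_def by (meson order_trans)

lemma similar_mono:
  assumes "similar X k F C D \<sigma> \<tau> \<sigma>' \<tau>'" "F' \<subseteq> F" "0 < C'" "C' \<le> C" "D' dvd D"
  shows "similar X k F' C' D' \<sigma> \<tau> \<sigma>' \<tau>'"
  using assms unfolding similar_def by (meson clip_eq_mono dvd_trans subsetD)

lemma val_dvd:
  assumes "\<forall>x\<in>X. D dvd \<sigma>' x - \<sigma> x" "\<forall>j<k. D dvd \<tau>' j - \<tau> j"
  shows "D dvd val X k p \<sigma>' \<tau>' - val X k p \<sigma> \<tau>"
proof -
  have "val X k p \<sigma>' \<tau>' - val X k p \<sigma> \<tau> =
      (\<Sum>x\<in>X. fst p x * (\<sigma>' x - \<sigma> x)) + (\<Sum>j<k. snd p j * (\<tau>' j - \<tau> j))"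
    by (simp add: val_def sum_subtractf right_diff_distrib)
  then show ?thesis
    using assms by (auto intro!: dvd_add dvd_sum dvd_mult)
qed

lemma val_cong: "(\<And>j. j < k \<Longrightarrow> \<tau> j = \<tau>' j) \<Longrightarrow> val X k p \<sigma> \<tau> = val X k p \<sigma> \<tau>'"
  by (simp add: val_def)

lemma val_Suc: "val X (Suc k) p \<sigma> \<tau> = val X k p \<sigma> \<tau> + snd p k * \<tau> k"
  by (simp add: val_def)

text \<open>Transfers clipped equality from a combination \<open>u\<close> back to a form
  \<open>h\<close> with \<open>a * h = u + e\<close>. If \<open>u = u'\<close>, cancel
  \<open>a\<close>. Otherwise both lie beyond
  \<open>C' \<ge> \<bar>a\<bar> * C + \<bar>e\<bar>\<close> on the same side, so
  \<open>a * h\<close> and \<open>a * h'\<close> lie beyond \<open>\<bar>a\<bar> * C\<close>, and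
  the sign of \<open>a\<close> decides on which side \<open>h\<close> and \<open>h'\<close> are
  saturated.\<close>

lemma clip_mult_eq:
  fixes a :: int
  assumes "clip C' u = clip C' u'" "a \<noteq> 0" "0 < C" "\<bar>a\<bar> * C + \<bar>e\<bar> \<le> C'"
    "a * h = u + e" "a * h' = u' + e"
  shows "clip C h = clip C h'"
proof -
  have 0: "0 < \<bar>a\<bar> * C" using assms by simp
  have up: "if a > 0 then C \<le> h else h \<le> - C" if "\<bar>a\<bar> * C \<le> a * h" for h
  proof (cases "a > 0")
    case True
    then show ?thesis using that by simp
  next
    case False
    then have "(-a) * C \<le> (-a) * (-h)" using that assms(2) by simp
    then have "C \<le> -h" using False assms(2) by (subst (asm) mult_le_cancel_left_pos) auto
    then show ?thesis using False by simp
  qed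
  have lo: "if a > 0 then h \<le> - C else C \<le> h" if "a * h \<le> - (\<bar>a\<bar> * C)" for h
  proof -
    have "\<bar>a\<bar> * C \<le> a * (-h)" using that by simp
    from up[OF this] show ?thesis by (auto split: if_splits)
  qed
  have C': "0 < C'" using assms(4) 0 by linarith
  consider "u = u'" | "C' \<le> u" "C' \<le> u'" | "u \<le> - C'" "u' \<le> - C'"
    using assms(1) clip_eq_iff[OF C'] by blast
  then show ?thesis
  proof cases
    case 1
    then have "a * h = a * h'" using assms by simp
    then show ?thesis using assms(2) by simp
  next
    case 2
    then have "\<bar>a\<bar> * C \<le> a * h" "\<bar>a\<bar> * C \<le> a * h'" using assms by linarith+
    then show ?thesis using up[of h] up[of h'] assms(3) by (auto simp: clip_eq_iff split: if_splits)
  next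
    case 3
    then have "a * h \<le> - (\<bar>a\<bar> * C)" "a * h' \<le> - (\<bar>a\<bar> * C)" using assms by linarith+
    then show ?thesis using lo[of h] lo[of h'] assms(3) by (auto simp: clip_eq_iff split: if_splits)
  qed
qed

text \<open>
  Moving the eliminated variable in steps of \<open>D\<close> towards a zero of the form \<open>q\<close> preserves all
  clipped values until the first time that some form becomes small; this form is the pivot.
\<close>

lemma shift_to_pivot:
  fixes v a :: "'q \<Rightarrow> int"
  assumes "q \<in> F" "a q \<noteq> 0" "\<And>p. p \<in> F \<Longrightarrow> \<bar>a p\<bar> \<le> A" "1 \<le> D" "0 < C"
  shows "\<exists>s. (\<forall>p\<in>F. clip C (v p + a p * (D * s)) = clip C (v p)) \<and>
    (\<exists>p\<in>F. a p \<noteq> 0 \<and> \<bar>v p + a p * (D * s)\<bar> \<le> C + A * D)"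
proof (induction "nat \<bar>v q\<bar>" arbitrary: v rule: less_induct)
  case less
  have AD: "\<bar>a p * D\<bar> \<le> A * D" if "p \<in> F" for p
    using assms(3)[OF that] assms(4) by (simp add: abs_mult)
  show ?case
  proof (cases "\<exists>p\<in>F. a p \<noteq> 0 \<and> \<bar>v p\<bar> \<le> C + A * D")
    case True
    then show ?thesis by (intro exI[of _ 0]) auto
  next
    case False
    then have big: "\<bar>v p\<bar> > C + A * D" if "p \<in> F" "a p \<noteq> 0" for p
      using that by force
    \<comment> \<open>One step of size \<open>D\<close> towards the zero of \<open>q\<close>. Since
      \<open>\<bar>v q\<bar>\<close> exceeds the step length, at most \<open>A * D\<close>, the step
      does not overshoot, and \<open>\<bar>v q\<bar>\<close> decreases strictly.\<close>
    define e where "e = (if (v q > 0) = (a q > 0) then -1 else 1 :: int)"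
    define v' where "v' = (\<lambda>p. v p + a p * (D * e))"
    have ae: "\<bar>a p * (D * e)\<bar> \<le> A * D" if "p \<in> F" for p
      using AD[OF that] by (simp add: e_def abs_mult)
    have sgn: "(a q * D > 0) = (a q > 0)" "(a q * D < 0) = (a q < 0)"
      using assms(4) by (auto simp: zero_less_mult_iff mult_less_0_iff)
    have "\<bar>v' q\<bar> < \<bar>v q\<bar>"
      using AD[OF assms(1)] big[OF assms(1,2)] sgn assms(2,5) unfolding v'_def e_def
      by (cases "a q > 0"; cases "v q > 0") auto
    then have "nat \<bar>v' q\<bar> < nat \<bar>v q\<bar>" by simp
    from less.hyps[of v', OF this] obtain s where
      s: "\<forall>p\<in>F. clip C (v' p + a p * (D * s)) = clip C (v' p)"
        "\<exists>p\<in>F. a p \<noteq> 0 \<and> \<bar>v' p + a p * (D * s)\<bar> \<le> C + A * D" by blast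
    \<comment> \<open>Every form that moves was further than \<open>C + A * D\<close> from 0 and
      moves by at most \<open>A * D\<close>, so it stays saturated on its side. This is the reason
      for the threshold in the definition of a small value.\<close>
    have "clip C (v' p) = clip C (v p)" if "p \<in> F" for p
    proof (cases "a p = 0")
      case False
      have "\<bar>v p\<bar> > C + A * D" "\<bar>v' p - v p\<bar> \<le> A * D"
        using big[OF that False] ae[OF that] by (auto simp: v'_def)
      then show ?thesis unfolding clip_eq_iff[OF assms(5)] by linarith
    qed (simp add: v'_def)
    moreover have "v' p + a p * (D * s) = v p + a p * (D * (s + e))" for p
      by (simp add: v'_def algebra_simps)
    ultimately show ?thesis using s by (intro exI[of _ "s + e"]) simp
  qed
qed

text \<open>Fraction-free Gaussian elimination: \<open>snd p k\<close> times \<open>q\<close> minus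
  \<open>snd q k\<close> times \<open>p\<close>, in which the coefficient of the variable
  \<open>k\<close> cancels.\<close>

definition comb :: "nat \<Rightarrow> form \<Rightarrow> form \<Rightarrow> form" where
  "comb k p q = (\<lambda>x. snd p k * fst q x - snd q k * fst p x, \<lambda>j. snd p k * snd q j - snd q k * snd p j)"

lemma val_comb: "val X k (comb k p q) \<sigma> \<tau> = snd p k * val X k q \<sigma> \<tau> - snd q k * val X k p \<sigma> \<tau>"
  by (simp add: val_def comb_def sum_distrib_left sum_subtractf algebra_simps)

lemma bounded_by_comb:
  assumes "bounded_by X (Suc k) A p" "bounded_by X (Suc k) A q"
  shows "bounded_by X k (2 * A * A) (comb k p q)"
proof -
  have *: "\<bar>a * b - c * d\<bar> \<le> 2 * A * A" if "\<bar>a\<bar> \<le> A" "\<bar>b\<bar> \<le> A" "\<bar>c\<bar> \<le> A" "\<bar>d\<bar> \<le> A" for a b c d :: int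
  proof -
    have "\<bar>a\<bar> * \<bar>b\<bar> \<le> A * A" "\<bar>c\<bar> * \<bar>d\<bar> \<le> A * A"
      using that by (auto intro!: mult_mono)
    then show ?thesis
      using abs_triangle_ineq4[of "a * b" "c * d"] by (simp add: abs_mult)
  qed
  show ?thesis
    using assms by (auto simp: bounded_by_def comb_def intro!: *)
qed

text \<open>Going back from the combinations to \<open>F\<close>: the variable \<open>k\<close> is
  chosen so that the pivot \<open>p\<close> takes the same value \<open>c\<close> on both sides.
  Every other form then satisfies \<open>a * q = comb k p q + snd q k * c\<close> with the same
  small error term on both sides, and \<open>clip_mult_eq\<close> applies. Solving for the variable
  divides by the pivot coefficient \<open>a\<close>, so congruence modulo \<open>a * D\<close> is
  required.\<close>

lemma lift_pivot:
  assumes F: "\<And>q. q \<in> F \<Longrightarrow> bounded_by X (Suc k) A q" and p: "p \<in> F" "snd p k \<noteq> 0" and "1 \<le> D" "0 < C" "0 \<le> A"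
    and c: "\<bar>val X (Suc k) p \<sigma> \<tau>\<bar> \<le> C + A * D"
    and C': "A * C + A * (C + A * D) \<le> C'"
    and similar: "similar X k (comb k p ` F) C' (snd p k * D) \<sigma> \<tau> \<sigma>' \<tau>'"
  shows "\<exists>\<tau>'. similar X (Suc k) F C D \<sigma> \<tau> \<sigma>' \<tau>'"
proof -
  let ?a = "snd p k" and ?c = "val X (Suc k) p \<sigma> \<tau>"
  have "?a * D dvd val X k p \<sigma>' \<tau>' - val X k p \<sigma> \<tau>"
    using similar by (intro val_dvd) (auto simp: similar_def)
  then obtain z where z: "val X k p \<sigma>' \<tau>' = val X k p \<sigma> \<tau> + ?a * D * z"
    by (metis dvdE diff_eq_eq add.commute)
  \<comment> \<open>The other variables have changed the pivot by \<open>a * D * z\<close>; moving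
    the variable \<open>k\<close> by \<open>- D * z\<close> cancels this and keeps its residue
    modulo \<open>D\<close>.\<close>
  define \<upsilon> where "\<upsilon> = \<tau>'(k := \<tau> k - D * z)"
  have \<upsilon>: "val X k q \<sigma>' \<upsilon> = val X k q \<sigma>' \<tau>'" for q
    by (rule val_cong) (simp add: \<upsilon>_def)
  have c': "val X (Suc k) p \<sigma>' \<upsilon> = ?c"
    using z by (simp add: val_Suc \<upsilon>) (simp add: \<upsilon>_def algebra_simps)
  have "clip C (val X (Suc k) q \<sigma> \<tau>) = clip C (val X (Suc k) q \<sigma>' \<upsilon>)" if q: "q \<in> F" for q
  proof (rule clip_mult_eq[where a = ?a and e = "snd q k * ?c" and C' = C'
        and u = "val X k (comb k p q) \<sigma> \<tau>" and u' = "val X k (comb k p q) \<sigma>' \<tau>'"])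
    show "clip C' (val X k (comb k p q) \<sigma> \<tau>) = clip C' (val X k (comb k p q) \<sigma>' \<tau>')"
      using similar q by (simp add: similar_def)
    have "\<bar>?a\<bar> * C \<le> A * C"
      using F[OF p(1)] \<open>0 < C\<close> by (auto simp: bounded_by_def intro!: mult_right_mono)
    moreover have "\<bar>snd q k\<bar> * \<bar>?c\<bar> \<le> A * (C + A * D)"
      using F[OF q] c \<open>0 \<le> A\<close> by (auto simp: bounded_by_def intro!: mult_mono)
    ultimately show "\<bar>?a\<bar> * C + \<bar>snd q k * ?c\<bar> \<le> C'"
      using C' by (simp add: abs_mult)
    show "?a * val X (Suc k) q \<sigma> \<tau> = val X k (comb k p q) \<sigma> \<tau> + snd q k * ?c"
      by (simp add: val_comb val_Suc algebra_simps)
    show "?a * val X (Suc k) q \<sigma>' \<upsilon> = val X k (comb k p q) \<sigma>' \<tau>' + snd q k * ?c"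
      unfolding c'[symmetric] by (simp add: val_comb val_Suc \<upsilon> algebra_simps)
  qed (use p \<open>0 < C\<close> in auto)
  moreover have "D dvd \<upsilon> j - \<tau> j" if "j < Suc k" for j
  proof (cases "j = k")
    case False
    then have "?a * D dvd \<tau>' j - \<tau> j"
      using that similar by (simp add: similar_def)
    then show ?thesis using False by (auto simp: \<upsilon>_def dest: dvd_mult_right)
  qed (simp add: \<upsilon>_def)
  moreover have "\<forall>x\<in>X. D dvd \<sigma>' x - \<sigma> x"
    using similar by (auto simp: similar_def dest: dvd_mult_right)
  ultimately show ?thesis
    unfolding similar_def by blast
qed

lemma similar_trans:
  assumes "similar X k F C D \<sigma> \<tau> \<sigma>' \<tau>'" "similar X k F C D \<sigma>' \<tau>' \<sigma>'' \<tau>''"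
  shows "similar X k F C D \<sigma> \<tau> \<sigma>'' \<tau>''"
proof -
  have *: "D dvd c - a" if "D dvd b - a" "D dvd c - b" for a b c :: int
    using dvd_add[OF that] by simp
  show ?thesis
    using assms unfolding similar_def by (metis *)
qed

text \<open>The pivot depends on the witness, so one similarity must serve all of them: take the
  union of the form sets and the product of the moduli over all pivots. Every branch starts again
  with at most \<open>N\<close> forms, so each variable costs one factor \<open>N\<close>. The
  logarithm \<open>w + 1\<close> grows by a factor 4 per variable, and that of the modulus by
  \<open>4 * N\<close>, because up to \<open>N\<close> moduli are multiplied.\<close>

lemma eliminate_block:
  assumes "finite F" "card F \<le> N" "1 \<le> N" "\<And>p. p \<in> F \<Longrightarrow> bounded_by X k (2 ^ w) p"
    "0 < C" "C \<le> 2 ^ w" "1 \<le> D" "D \<le> 2 ^ w"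
  shows "\<exists>F' D'. finite F' \<and> card F' \<le> N ^ (k + 1) \<and> (\<forall>p\<in>F'. bounded_by X 0 (2 ^ (4 ^ k * (w + 1))) p) \<and>
    1 \<le> D' \<and> D' \<le> 2 ^ ((4 * N) ^ k * (w + 1)) \<and>
    (\<forall>\<sigma> \<sigma>' \<tau>0. similar X 0 F' (2 ^ (4 ^ k * (w + 1))) D' \<sigma> \<tau>0 \<sigma>' \<tau>0 \<longrightarrow>
      (\<forall>\<tau>. \<exists>\<tau>'. similar X k F C D \<sigma> \<tau> \<sigma>' \<tau>'))"
  using assms
proof (induction k arbitrary: F w C D)
  case 0
  have "(2::int) ^ w \<le> 2 ^ (w + 1)" by simp
  then have le: "C \<le> 2 ^ (w + 1)" "D \<le> 2 ^ (w + 1)" and "\<forall>p\<in>F. bounded_by X 0 (2 ^ (w + 1)) p"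
    using 0 bounded_by_mono[of X 0 "2 ^ w" _ "2 ^ (w + 1)"] by (auto intro: order_trans)
  moreover have "similar X 0 F C D \<sigma> \<tau> \<sigma>' \<tau>" if "similar X 0 F (2 ^ (w + 1)) D \<sigma> \<tau>0 \<sigma>' \<tau>0" for \<sigma> \<sigma>' \<tau>0 \<tau>
  proof -
    have "similar X 0 F C D \<sigma> \<tau>0 \<sigma>' \<tau>0"
      using that 0 le by (auto elim: similar_mono)
    then show ?thesis by (simp add: similar_def val_def)
  qed
  ultimately have "\<forall>p\<in>F. bounded_by X 0 (2 ^ (4 ^ 0 * (w + 1))) p" "D \<le> 2 ^ ((4 * N) ^ 0 * (w + 1))"
    "\<forall>\<sigma> \<sigma>' \<tau>0. similar X 0 F (2 ^ (4 ^ 0 * (w + 1))) D \<sigma> \<tau>0 \<sigma>' \<tau>0 \<longrightarrow>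
      (\<forall>\<tau>. \<exists>\<tau>'. similar X 0 F C D \<sigma> \<tau> \<sigma>' \<tau>')"
    unfolding power_0 mult_1 by blast+
  then show ?case
    using 0(1,2,7) by (intro exI[of _ F] exI[of _ D] conjI) simp_all
next
  case (Suc k)
  define P where "P = {p \<in> F. snd p k \<noteq> 0}"
  have fin: "finite P" "card P \<le> N"
    using Suc.prems(1,2) card_mono[of F P] by (auto simp: P_def)
  \<comment> \<open>Covers the new coefficients, at most \<open>2 ^ (2 * w + 1)\<close>, the new
    moduli, at most \<open>2 ^ (2 * w)\<close>, and the new clipping constant, at most
    \<open>2 ^ (3 * w + 2)\<close>, while \<open>W + 1 \<le> 4 * (w + 1)\<close>.\<close>
  define W where "W = 4 * w + 2"
  have W: "4 ^ k * (W + 1) \<le> 4 ^ Suc k * (w + 1)"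
    by (simp add: W_def)
  let ?C = "2 ^ (4 ^ k * (W + 1)) :: int" and ?C' = "2 ^ (4 ^ Suc k * (w + 1)) :: int"
  have CC: "?C \<le> ?C'"
    using W by (intro power_increasing) auto
  show ?case
  proof (cases "P = {}")
    \<comment> \<open>The variable \<open>k\<close> occurs in no form, so its old value can be kept
      as the new witness.\<close>
    case True
    have "\<And>p. p \<in> F \<Longrightarrow> bounded_by X k (2 ^ w) p"
      using Suc.prems(4) by (force simp: bounded_by_def)
    from Suc.IH[OF Suc.prems(1-3) this Suc.prems(5-8)] obtain F' D' where
      *: "finite F'" "card F' \<le> N ^ (k + 1)" "\<forall>p\<in>F'. bounded_by X 0 (2 ^ (4 ^ k * (w + 1))) p"
        "1 \<le> D'" "D' \<le> 2 ^ ((4 * N) ^ k * (w + 1))"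
        "\<And>\<sigma> \<sigma>' \<tau>0 \<tau>. similar X 0 F' (2 ^ (4 ^ k * (w + 1))) D' \<sigma> \<tau>0 \<sigma>' \<tau>0 \<Longrightarrow>
          \<exists>\<tau>'. similar X k F C D \<sigma> \<tau> \<sigma>' \<tau>'"
      by blast
    have le: "(2 :: int) ^ (4 ^ k * (w + 1)) \<le> ?C'"
      by (intro power_increasing mult_right_mono) auto
    have "card F' \<le> N ^ (Suc k + 1)"
      using *(2) power_increasing[of "k + 1" "Suc k + 1" N] Suc.prems(3) by linarith
    moreover have "D' \<le> 2 ^ ((4 * N) ^ Suc k * (w + 1))"
      using Suc.prems(3) by (intro order_trans[OF *(5)] power_increasing mult_right_mono) auto
    moreover have "\<exists>\<tau>'. similar X (Suc k) F C D \<sigma> \<tau> \<sigma>' \<tau>'" if "similar X 0 F' ?C' D' \<sigma> \<tau>0 \<sigma>' \<tau>0" for \<sigma> \<sigma>' \<tau>0 \<tau>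
    proof -
      have "similar X 0 F' (2 ^ (4 ^ k * (w + 1))) D' \<sigma> \<tau>0 \<sigma>' \<tau>0"
        by (rule similar_mono[OF that]) (use le in auto)
      from *(6)[OF this] obtain \<tau>' where \<tau>': "similar X k F C D \<sigma> \<tau> \<sigma>' \<tau>'" by blast
      have "val X (Suc k) p \<sigma> \<tau> = val X k p \<sigma> \<tau>" "val X (Suc k) p \<sigma>' (\<tau>'(k := \<tau> k)) = val X k p \<sigma>' \<tau>'"
        if "p \<in> F" for p
      proof -
        have "snd p k = 0" using that True unfolding P_def by blast
        then show "val X (Suc k) p \<sigma> \<tau> = val X k p \<sigma> \<tau>" "val X (Suc k) p \<sigma>' (\<tau>'(k := \<tau> k)) = val X k p \<sigma>' \<tau>'"
          by (auto simp: val_Suc intro: val_cong)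
      qed
      then have "similar X (Suc k) F C D \<sigma> \<tau> \<sigma>' (\<tau>'(k := \<tau> k))"
        using \<tau>' by (auto simp: similar_def)
      then show ?thesis by blast
    qed
    ultimately show ?thesis
      using *(1,3,4) le bounded_by_mono
      by (intro exI[of _ F'] exI[of _ D']) auto
  next
    case False
    let ?A = "2 ^ w :: int"
    have w0: "1 \<le> ?A" by simp
    \<comment> \<open>The least clipping constant that \<open>lift_pivot\<close> accepts for
      \<open>A = 2 ^ w\<close>.\<close>
    define C1 where "C1 = ?A * C + ?A * (C + ?A * D)"
    have "\<exists>F' D'. finite F' \<and> card F' \<le> N ^ (k + 1) \<and> (\<forall>p\<in>F'. bounded_by X 0 ?C p) \<and>
      1 \<le> D' \<and> D' \<le> 2 ^ ((4 * N) ^ k * (W + 1)) \<and>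
      (\<forall>\<sigma> \<sigma>' \<tau>0. similar X 0 F' ?C D' \<sigma> \<tau>0 \<sigma>' \<tau>0 \<longrightarrow>
        (\<forall>\<tau>. \<exists>\<tau>'. similar X k (comb k p ` F) C1 (\<bar>snd p k\<bar> * D) \<sigma> \<tau> \<sigma>' \<tau>'))" if "p \<in> P" for p
    proof (rule Suc.IH)
      have p: "p \<in> F" "snd p k \<noteq> 0" "\<bar>snd p k\<bar> \<le> ?A"
        using that Suc.prems(4) by (auto simp: P_def bounded_by_def)
      show "finite (comb k p ` F)" "1 \<le> N" using Suc.prems by auto
      show "card (comb k p ` F) \<le> N"
        using card_image_le[OF Suc.prems(1), of "comb k p"] Suc.prems(2) by linarith
      have AA: "?A * ?A = 2 ^ (2 * w)" "?A * ?A * ?A = 2 ^ (3 * w)"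
        by (simp_all flip: power_add)
      show "bounded_by X k (2 ^ W) q" if "q \<in> comb k p ` F" for q
      proof -
        have "bounded_by X k (2 * ?A * ?A) q"
          using that bounded_by_comb[OF Suc.prems(4)[OF p(1)] Suc.prems(4)] by blast
        moreover have "2 * ?A * ?A = 2 ^ (2 * w + 1)"
          using AA by simp
        moreover have "(2::int) ^ (2 * w + 1) \<le> 2 ^ W"
          unfolding W_def by (intro power_increasing) auto
        ultimately show ?thesis using bounded_by_mono by metis
      qed
      show "0 < C1"
        using Suc.prems unfolding C1_def by (intro add_pos_pos mult_pos_pos) auto
      have "C1 \<le> ?A * ?A + ?A * (?A + ?A * ?A)"
        unfolding C1_def using Suc.prems by (intro add_mono mult_left_mono) auto
      also have "\<dots> = 2 * 2 ^ (2 * w) + 2 ^ (3 * w)"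
        using AA by (simp add: algebra_simps)
      also have "\<dots> \<le> 2 * 2 ^ (3 * w) + 2 ^ (3 * w)"
        by (intro add_mono mult_left_mono power_increasing) auto
      also have "\<dots> \<le> 2 ^ (3 * w + 2)" by simp
      also have "\<dots> \<le> 2 ^ W"
        unfolding W_def by (intro power_increasing) auto
      finally show "C1 \<le> 2 ^ W" .
      show "1 \<le> \<bar>snd p k\<bar> * D"
        using p(2) Suc.prems(7) by (smt (verit) mult_le_cancel_left1 mult_left_mono)
      have "\<bar>snd p k\<bar> * D \<le> ?A * ?A"
        using p Suc.prems by (intro mult_mono) auto
      also have "\<dots> \<le> 2 ^ W"
        unfolding AA W_def by (intro power_increasing) auto
      finally show "\<bar>snd p k\<bar> * D \<le> 2 ^ W" .
    qed
    then obtain F' D' where F'D': "\<And>p. p \<in> P \<Longrightarrow> finite (F' p) \<and> card (F' p) \<le> N ^ (k + 1) \<and> (\<forall>q\<in>F' p. bounded_by X 0 ?C q) \<and>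
      1 \<le> D' p \<and> D' p \<le> 2 ^ ((4 * N) ^ k * (W + 1)) \<and>
      (\<forall>\<sigma> \<sigma>' \<tau>0. similar X 0 (F' p) ?C (D' p) \<sigma> \<tau>0 \<sigma>' \<tau>0 \<longrightarrow>
        (\<forall>\<tau>. \<exists>\<tau>'. similar X k (comb k p ` F) C1 (\<bar>snd p k\<bar> * D) \<sigma> \<tau> \<sigma>' \<tau>'))"
      by metis
    show ?thesis
    proof (intro exI[of _ "\<Union>p\<in>P. F' p"] exI[of _ "\<Prod>p\<in>P. D' p"] conjI allI impI ballI)
      show "finite (\<Union>p\<in>P. F' p)" using fin F'D' by auto
      have "card (\<Union>p\<in>P. F' p) \<le> (\<Sum>p\<in>P. card (F' p))"
        by (rule card_UN_le[OF fin(1)])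
      also have "\<dots> \<le> card P * N ^ (k + 1)"
        using F'D' sum_bounded_above[of P "\<lambda>p. card (F' p)" "N ^ (k + 1)"] by simp
      also have "\<dots> \<le> N ^ (Suc k + 1)"
        using fin(2) by simp
      finally show "card (\<Union>p\<in>P. F' p) \<le> N ^ (Suc k + 1)" .
      show "bounded_by X 0 ?C' q" if "q \<in> (\<Union>p\<in>P. F' p)" for q
        using that F'D' bounded_by_mono[OF _ CC] by blast
      show "1 \<le> (\<Prod>p\<in>P. D' p)"
        using F'D' by (intro prod_ge_1) auto
      have "(\<Prod>p\<in>P. D' p) \<le> (\<Prod>p\<in>P. 2 ^ ((4 * N) ^ k * (W + 1)))"
        using F'D' by (intro prod_mono) force
      also have "\<dots> = 2 ^ (card P * ((4 * N) ^ k * (W + 1)))"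
        by (simp add: power_mult[symmetric] mult.commute)
      also have "\<dots> \<le> 2 ^ ((4 * N) ^ Suc k * (w + 1))"
      proof (rule power_increasing)
        have "card P * ((4 * N) ^ k * (W + 1)) \<le> N * ((4 * N) ^ k * (4 * (w + 1)))"
          using fin(2) by (intro mult_mono) (auto simp: W_def)
        then show "card P * ((4 * N) ^ k * (W + 1)) \<le> (4 * N) ^ Suc k * (w + 1)"
          by (simp only: power_Suc ac_simps)
      qed simp
      finally show "(\<Prod>p\<in>P. D' p) \<le> 2 ^ ((4 * N) ^ Suc k * (w + 1))" .
    next
      fix \<sigma> \<sigma>' \<tau>0 \<tau>
      assume similar: "similar X 0 (\<Union>p\<in>P. F' p) ?C' (\<Prod>p\<in>P. D' p) \<sigma> \<tau>0 \<sigma>' \<tau>0"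
      obtain q where q: "q \<in> F" "snd q k \<noteq> 0" using False unfolding P_def by blast
      have A: "\<bar>snd p k\<bar> \<le> ?A" if "p \<in> F" for p
        using Suc.prems(4)[OF that] by (auto simp: bounded_by_def)
      from shift_to_pivot[where v = "\<lambda>p. val X (Suc k) p \<sigma> \<tau>" and a = "\<lambda>p. snd p k", OF q A Suc.prems(7,5)]
      obtain s p where s: "\<forall>p\<in>F. clip C (val X (Suc k) p \<sigma> \<tau> + snd p k * (D * s)) = clip C (val X (Suc k) p \<sigma> \<tau>)"
        and p: "p \<in> F" "snd p k \<noteq> 0" "\<bar>val X (Suc k) p \<sigma> \<tau> + snd p k * (D * s)\<bar> \<le> C + ?A * D"
        by blast
      \<comment> \<open>The witness is first moved, within its similarity class, to one where
        \<open>p\<close> is small; only then is \<open>p\<close> used as a pivot.\<close>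
      define \<upsilon> where "\<upsilon> = \<tau>(k := \<tau> k + D * s)"
      have \<upsilon>: "val X (Suc k) p \<sigma> \<upsilon> = val X (Suc k) p \<sigma> \<tau> + snd p k * (D * s)" for p
        using val_cong[of k \<upsilon> \<tau> X p \<sigma>] by (simp add: val_Suc) (simp add: \<upsilon>_def algebra_simps)
      have s1: "similar X (Suc k) F C D \<sigma> \<tau> \<sigma> \<upsilon>"
        using s by (auto simp: similar_def \<upsilon>) (auto simp: \<upsilon>_def)
      have "p \<in> P" using p by (simp add: P_def)
      have "similar X 0 (F' p) ?C (D' p) \<sigma> \<tau>0 \<sigma>' \<tau>0"
        by (rule similar_mono[OF similar]) (use \<open>p \<in> P\<close> CC fin in \<open>auto intro: dvd_prodI\<close>)
      then obtain \<tau>' where \<tau>': "similar X k (comb k p ` F) C1 (\<bar>snd p k\<bar> * D) \<sigma> \<upsilon> \<sigma>' \<tau>'"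
        using F'D'[OF \<open>p \<in> P\<close>] by blast
      have "0 < C1"
        using Suc.prems unfolding C1_def by (intro add_pos_pos mult_pos_pos) auto
      \<comment> \<open>The absolute value kept the modulus positive for the induction; divisibility
        ignores the sign.\<close>
      then have \<tau>'': "similar X k (comb k p ` F) C1 (snd p k * D) \<sigma> \<upsilon> \<sigma>' \<tau>'"
        by (intro similar_mono[OF \<tau>']) (auto intro!: mult_dvd_mono)
      have "\<exists>\<tau>'. similar X (Suc k) F C D \<sigma> \<upsilon> \<sigma>' \<tau>'"
        by (rule lift_pivot[OF Suc.prems(4) p(1,2) Suc.prems(7,5) _ _ _ \<tau>''])
          (use p(3) in \<open>auto simp: \<upsilon> C1_def\<close>)
      then show "\<exists>\<tau>'. similar X (Suc k) F C D \<sigma> \<tau> \<sigma>' \<tau>'"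
        using similar_trans[OF s1] by blast
    qed
  qed
qed

section \<open>Sets definable with one block of quantifiers\<close>

text \<open>
  \<open>U\<close> is the projection of a relation on \<open>\<sigma>\<close> and \<open>\<tau>\<^sub>0, \<dots>, \<tau>\<^sub>k\<^sub>-\<^sub>1\<close> that is determined by
  clipped values and residues; \<open>G\<close> bounds the number of forms and the logarithms of everything else.
\<close>

definition block_definable :: "nat set \<Rightarrow> nat \<Rightarrow> nat \<Rightarrow> ((nat \<Rightarrow> int) \<Rightarrow> bool) \<Rightarrow> bool" where
  "block_definable X k G U \<longleftrightarrow> (\<exists>F C D w V. finite F \<and> card F \<le> G \<and> w < G \<and> (\<forall>p\<in>F. bounded_by X k (2 ^ w) p) \<and>
     0 < C \<and> C \<le> 2 ^ w \<and> 1 \<le> D \<and> D \<le> 2 ^ w \<and>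
     (\<forall>\<sigma> \<tau> \<sigma>' \<tau>'. similar X k F C D \<sigma> \<tau> \<sigma>' \<tau>' \<longrightarrow> V \<sigma> \<tau> \<longrightarrow> V \<sigma>' \<tau>') \<and>
     (\<forall>\<sigma>. U \<sigma> \<longleftrightarrow> (\<exists>\<tau>. V \<sigma> \<tau>)))"

lemma block_definableI:
  assumes "finite F" "card F \<le> G" "w < G" "\<And>p. p \<in> F \<Longrightarrow> bounded_by X k (2 ^ w) p"
    "0 < C" "C \<le> 2 ^ w" "1 \<le> D" "D \<le> 2 ^ w"
    "\<And>\<sigma> \<tau> \<sigma>' \<tau>'. similar X k F C D \<sigma> \<tau> \<sigma>' \<tau>' \<Longrightarrow> V \<sigma> \<tau> \<Longrightarrow> V \<sigma>' \<tau>'"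
    "\<And>\<sigma>. U \<sigma> \<longleftrightarrow> (\<exists>\<tau>. V \<sigma> \<tau>)"
  shows "block_definable X k G U"
  unfolding block_definable_def using assms
  by (intro exI[of _ F] exI[of _ C] exI[of _ D] exI[of _ w] exI[of _ V]) blast

lemma block_definableE:
  assumes "block_definable X k G U"
  obtains F C D w V where "finite F" "card F \<le> G" "w < G" "\<And>p. p \<in> F \<Longrightarrow> bounded_by X k (2 ^ w) p"
    "0 < C" "C \<le> 2 ^ w" "1 \<le> D" "D \<le> 2 ^ w"
    "\<And>\<sigma> \<tau> \<sigma>' \<tau>'. similar X k F C D \<sigma> \<tau> \<sigma>' \<tau>' \<Longrightarrow> V \<sigma> \<tau> \<Longrightarrow> V \<sigma>' \<tau>'"
    "\<And>\<sigma>. U \<sigma> \<longleftrightarrow> (\<exists>\<tau>. V \<sigma> \<tau>)"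
proof -
  obtain F C D w V where "finite F \<and> card F \<le> G \<and> w < G \<and> (\<forall>p\<in>F. bounded_by X k (2 ^ w) p) \<and>
     0 < C \<and> C \<le> 2 ^ w \<and> 1 \<le> D \<and> D \<le> 2 ^ w \<and>
     (\<forall>\<sigma> \<tau> \<sigma>' \<tau>'. similar X k F C D \<sigma> \<tau> \<sigma>' \<tau>' \<longrightarrow> V \<sigma> \<tau> \<longrightarrow> V \<sigma>' \<tau>') \<and>
     (\<forall>\<sigma>. U \<sigma> \<longleftrightarrow> (\<exists>\<tau>. V \<sigma> \<tau>))"
    using assms unfolding block_definable_def by (elim exE)
  then show thesis
    by (intro that[of F w C D V]) blast+
qed

lemma block_definable_mono:
  assumes "block_definable X k G U" "G \<le> H"
  shows "block_definable X k H U"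
proof -
  obtain F C D w V where *: "finite F" "card F \<le> G" "w < G" "\<And>p. p \<in> F \<Longrightarrow> bounded_by X k (2 ^ w) p"
    "0 < C" "C \<le> 2 ^ w" "1 \<le> D" "D \<le> 2 ^ w"
    "\<And>\<sigma> \<tau> \<sigma>' \<tau>'. similar X k F C D \<sigma> \<tau> \<sigma>' \<tau>' \<Longrightarrow> V \<sigma> \<tau> \<Longrightarrow> V \<sigma>' \<tau>'"
    "\<And>\<sigma>. U \<sigma> \<longleftrightarrow> (\<exists>\<tau>. V \<sigma> \<tau>)"
    by (rule block_definableE[OF assms(1)]) (rule that)
  show ?thesis
    by (rule block_definableI[OF *(1) order_trans[OF *(2) assms(2)] less_le_trans[OF *(3) assms(2)] *(4-10)])
qed

section \<open>Closure properties of block-definable sets\<close>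

lemma block_definable_pos: "block_definable X k G U \<Longrightarrow> 1 \<le> G"
  by (erule block_definableE) linarith

lemma similar_sym: "similar X k F C D \<sigma> \<tau> \<sigma>' \<tau>' \<Longrightarrow> similar X k F C D \<sigma>' \<tau>' \<sigma> \<tau>"
  by (auto simp: similar_def dvd_diff_commute)

lemma similar_0: "similar X 0 F C D \<sigma> \<tau> \<sigma>' \<tau>' \<Longrightarrow> similar X 0 F C D \<sigma> \<upsilon> \<sigma>' \<upsilon>'"
  by (simp add: similar_def val_def)

text \<open>Without block variables the set is a union of classes of the symmetric relation
  \<open>similar\<close>, and so is its complement. With an open block it is only a projection, so a
  block has to be eliminated before a negation.\<close>

lemma block_definable_0_compl:
  assumes "block_definable X 0 G U"
  shows "block_definable X 0 G (\<lambda>\<sigma>. \<not> U \<sigma>)"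
  using assms
proof (rule block_definableE)
  fix F C D w V
  assume F: "finite F" "card F \<le> G" "w < G" "\<And>p. p \<in> F \<Longrightarrow> bounded_by X 0 (2 ^ w) p"
    "0 < C" "C \<le> 2 ^ w" "1 \<le> D" "D \<le> 2 ^ w"
    and V: "\<And>\<sigma> \<tau> \<sigma>' \<tau>'. similar X 0 F C D \<sigma> \<tau> \<sigma>' \<tau>' \<Longrightarrow> V \<sigma> \<tau> \<Longrightarrow> V \<sigma>' \<tau>'"
      "\<And>\<sigma>. U \<sigma> \<longleftrightarrow> (\<exists>\<tau>. V \<sigma> \<tau>)"
  show ?thesis
  proof (rule block_definableI[OF F, where V = "\<lambda>\<sigma> \<tau>. \<not> U \<sigma>"])
    fix \<sigma> \<sigma>' \<tau> \<tau>' :: "nat \<Rightarrow> int"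
    assume "similar X 0 F C D \<sigma> \<tau> \<sigma>' \<tau>'"
    then show "\<not> U \<sigma> \<Longrightarrow> \<not> U \<sigma>'"
      using V by (metis similar_0 similar_sym)
  qed auto
qed

text \<open>The two blocks are placed side by side and the forms are padded with zero coefficients,
  so numbers of forms add, and multiplying the moduli adds logarithms. The condition on
  \<open>b\<close> says that it commutes with taking separate witnesses, as conjunction and
  disjunction do; when there are no block variables any connective is allowed. Disjuncts do not
  share variables either, in accordance with \<open>qbl_q\<close>, which adds in both cases.\<close>

lemma block_definable_combine:
  assumes U1: "block_definable X k1 G1 U1" and U2: "block_definable X k2 G2 U2"
    and b: "k1 + k2 = 0 \<or> (\<forall>(P :: (nat \<Rightarrow> int) \<Rightarrow> bool) (Q :: (nat \<Rightarrow> int) \<Rightarrow> bool).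
      (\<exists>\<tau> \<upsilon>. b (P \<tau>) (Q \<upsilon>)) \<longleftrightarrow> b (\<exists>\<tau>. P \<tau>) (\<exists>\<upsilon>. Q \<upsilon>))"
  shows "block_definable X (k1 + k2) (G1 + G2) (\<lambda>\<sigma>. b (U1 \<sigma>) (U2 \<sigma>))"
proof -
  obtain F1 C1 D1 w1 V1 where
    1: "finite F1" "card F1 \<le> G1" "w1 < G1" "\<And>p. p \<in> F1 \<Longrightarrow> bounded_by X k1 (2 ^ w1) p"
      "0 < C1" "C1 \<le> 2 ^ w1" "1 \<le> D1" "D1 \<le> 2 ^ w1"
      "\<And>\<sigma> \<tau> \<sigma>' \<tau>'. similar X k1 F1 C1 D1 \<sigma> \<tau> \<sigma>' \<tau>' \<Longrightarrow> V1 \<sigma> \<tau> \<Longrightarrow> V1 \<sigma>' \<tau>'"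
      "\<And>\<sigma>. U1 \<sigma> \<longleftrightarrow> (\<exists>\<tau>. V1 \<sigma> \<tau>)"
    by (rule block_definableE[OF U1]) (rule that)
  obtain F2 C2 D2 w2 V2 where
    2: "finite F2" "card F2 \<le> G2" "w2 < G2" "\<And>p. p \<in> F2 \<Longrightarrow> bounded_by X k2 (2 ^ w2) p"
      "0 < C2" "C2 \<le> 2 ^ w2" "1 \<le> D2" "D2 \<le> 2 ^ w2"
      "\<And>\<sigma> \<tau> \<sigma>' \<tau>'. similar X k2 F2 C2 D2 \<sigma> \<tau> \<sigma>' \<tau>' \<Longrightarrow> V2 \<sigma> \<tau> \<Longrightarrow> V2 \<sigma>' \<tau>'"
      "\<And>\<sigma>. U2 \<sigma> \<longleftrightarrow> (\<exists>\<tau>. V2 \<sigma> \<tau>)"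
    by (rule block_definableE[OF U2]) (rule that)
  define \<alpha> :: "form \<Rightarrow> form" where "\<alpha> = (\<lambda>p. (fst p, \<lambda>j. if j < k1 then snd p j else 0))"
  define \<beta> :: "form \<Rightarrow> form" where "\<beta> = (\<lambda>p. (fst p, \<lambda>j. if j < k1 then 0 else snd p (j - k1)))"
  define sh :: "(nat \<Rightarrow> int) \<Rightarrow> nat \<Rightarrow> int" where "sh = (\<lambda>\<tau> j. \<tau> (k1 + j))"
  have split: "(\<Sum>j<k1 + k2. h j) = (\<Sum>j<k1. h j) + (\<Sum>j<k2. h (k1 + j))" for h :: "nat \<Rightarrow> int"
    by (induction k2) auto
  have \<alpha>: "val X (k1 + k2) (\<alpha> p) \<sigma> \<tau> = val X k1 p \<sigma> \<tau>" for p \<sigma> \<tau>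
    by (simp add: val_def \<alpha>_def split)
  have \<beta>: "val X (k1 + k2) (\<beta> p) \<sigma> \<tau> = val X k2 p \<sigma> (sh \<tau>)" for p \<sigma> \<tau>
    by (simp add: val_def \<beta>_def sh_def split)
  let ?F = "\<alpha> ` F1 \<union> \<beta> ` F2" and ?C = "max C1 C2" and ?D = "D1 * D2" and ?w = "w1 + w2"
  have le: "(2 :: int) ^ w1 \<le> 2 ^ ?w" "(2 :: int) ^ w2 \<le> 2 ^ ?w"
    by (auto intro!: power_increasing)
  have sim1: "similar X k1 F1 C1 D1 \<sigma> \<tau> \<sigma>' \<tau>'" if "similar X (k1 + k2) ?F ?C ?D \<sigma> \<tau> \<sigma>' \<tau>'" for \<sigma> \<tau> \<sigma>' \<tau>'
  proof -
    have "similar X (k1 + k2) (\<alpha> ` F1) C1 D1 \<sigma> \<tau> \<sigma>' \<tau>'"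
      using 1(5) by (intro similar_mono[OF that]) auto
    then show ?thesis by (simp add: similar_def \<alpha>)
  qed
  have sim2: "similar X k2 F2 C2 D2 \<sigma> (sh \<tau>) \<sigma>' (sh \<tau>')" if "similar X (k1 + k2) ?F ?C ?D \<sigma> \<tau> \<sigma>' \<tau>'" for \<sigma> \<tau> \<sigma>' \<tau>'
  proof -
    have "similar X (k1 + k2) (\<beta> ` F2) C2 D2 \<sigma> \<tau> \<sigma>' \<tau>'"
      using 2(5) by (intro similar_mono[OF that]) auto
    then show ?thesis by (simp add: similar_def \<beta> sh_def)
  qed
  show ?thesis
  proof (rule block_definableI[where F = ?F and C = ?C and D = ?D and w = ?w
        and V = "\<lambda>\<sigma> \<tau>. b (V1 \<sigma> \<tau>) (V2 \<sigma> (sh \<tau>))"])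
    have "card ?F \<le> card (\<alpha> ` F1) + card (\<beta> ` F2)"
      by (rule card_Un_le)
    also have "\<dots> \<le> G1 + G2"
      using card_image_le[OF 1(1), of \<alpha>] card_image_le[OF 2(1), of \<beta>] 1(2) 2(2) by linarith
    finally show "card ?F \<le> G1 + G2" .
    show "bounded_by X (k1 + k2) (2 ^ ?w) p" if "p \<in> ?F" for p
    proof -
      have "p \<in> \<alpha> ` F1 \<or> p \<in> \<beta> ` F2" using that by blast
      then show ?thesis
      proof
        assume "p \<in> \<alpha> ` F1"
        then obtain q where q: "q \<in> F1" "p = \<alpha> q" by blast
        from bounded_by_mono[OF 1(4)[OF q(1)] le(1)] show ?thesis
          by (auto simp: bounded_by_def q(2) \<alpha>_def)
      next
        assume "p \<in> \<beta> ` F2"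
        then obtain q where q: "q \<in> F2" "p = \<beta> q" by blast
        from bounded_by_mono[OF 2(4)[OF q(1)] le(2)] show ?thesis
          by (auto simp: bounded_by_def q(2) \<beta>_def)
      qed
    qed
    show "?C \<le> 2 ^ ?w" using order_trans[OF 1(6) le(1)] order_trans[OF 2(6) le(2)] by simp
    show "1 \<le> ?D" using mult_mono[of 1 D1 1 D2] 1(7) 2(7) by simp
    show "?D \<le> 2 ^ ?w" unfolding power_add using 1(7,8) 2(7,8) by (intro mult_mono) auto
    show "b (V1 \<sigma>' \<tau>') (V2 \<sigma>' (sh \<tau>'))" if "similar X (k1 + k2) ?F ?C ?D \<sigma> \<tau> \<sigma>' \<tau>'" "b (V1 \<sigma> \<tau>) (V2 \<sigma> (sh \<tau>))" for \<sigma> \<tau> \<sigma>' \<tau>'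
    proof -
      have "V1 \<sigma> \<tau> = V1 \<sigma>' \<tau>'"
        using 1(9)[OF sim1[OF that(1)]] 1(9)[OF similar_sym[OF sim1[OF that(1)]]] by blast
      moreover have "V2 \<sigma> (sh \<tau>) = V2 \<sigma>' (sh \<tau>')"
        using 2(9)[OF sim2[OF that(1)]] 2(9)[OF similar_sym[OF sim2[OF that(1)]]] by blast
      ultimately show ?thesis using that(2) by simp
    qed
    show "b (U1 \<sigma>) (U2 \<sigma>) \<longleftrightarrow> (\<exists>\<tau>. b (V1 \<sigma> \<tau>) (V2 \<sigma> (sh \<tau>)))" for \<sigma>
    proof -
      have "\<exists>\<upsilon>. b (V1 \<sigma> \<upsilon>) (V2 \<sigma> (sh \<upsilon>))" if "b (V1 \<sigma> \<tau>) (V2 \<sigma> \<tau>')" for \<tau> \<tau>'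
      proof -
        \<comment> \<open>Glues independent witnesses. \<open>V1\<close> sees only the first
          \<open>k1\<close> entries, because agreement there already gives similarity.\<close>
        define \<upsilon> where "\<upsilon> = (\<lambda>j. if j < k1 then \<tau> j else \<tau>' (j - k1))"
        have "val X k1 p \<sigma> \<tau> = val X k1 p \<sigma> \<upsilon>" for p
          by (rule val_cong) (simp add: \<upsilon>_def)
        then have s: "similar X k1 F1 C1 D1 \<sigma> \<tau> \<sigma> \<upsilon>"
          by (simp add: similar_def) (simp add: \<upsilon>_def)
        have "V1 \<sigma> \<tau> = V1 \<sigma> \<upsilon>"
          using 1(9)[OF s] 1(9)[OF similar_sym[OF s]] by blast
        moreover have "sh \<upsilon> = \<tau>'"
          by (simp add: sh_def \<upsilon>_def)
        ultimately show ?thesis using that by auto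
      qed
      then have "(\<exists>\<tau>. b (V1 \<sigma> \<tau>) (V2 \<sigma> (sh \<tau>))) \<longleftrightarrow> (\<exists>\<tau> \<upsilon>. b (V1 \<sigma> \<tau>) (V2 \<sigma> \<upsilon>))"
        by blast
      also have "\<dots> \<longleftrightarrow> b (U1 \<sigma>) (U2 \<sigma>)"
        using b
      proof
        assume 0: "k1 + k2 = 0"
        have s: "similar X 0 F C D \<sigma> \<tau> \<sigma> \<upsilon>" for F C D \<tau> \<upsilon>
          by (simp add: similar_def val_def)
        have "V1 \<sigma> \<tau> = U1 \<sigma>" "V2 \<sigma> \<tau> = U2 \<sigma>" for \<tau>
          using 0 1(9)[of \<sigma> _ \<sigma>] 2(9)[of \<sigma> _ \<sigma>] s unfolding 1(10) 2(10) by auto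
        then show ?thesis by simp
      next
        assume "\<forall>P Q. (\<exists>\<tau> \<upsilon>. b (P \<tau>) (Q \<upsilon>)) \<longleftrightarrow> b (\<exists>\<tau> :: nat \<Rightarrow> int. P \<tau>) (\<exists>\<upsilon> :: nat \<Rightarrow> int. Q \<upsilon>)"
        then show ?thesis by (simp add: 1(10) 2(10))
      qed
      finally show ?thesis ..
    qed
  qed (use 1(1,3,5) 2(1,3,5) in auto)
qed

lemma block_definable_conj:
  assumes "block_definable X k1 G1 U1" "block_definable X k2 G2 U2"
  shows "block_definable X (k1 + k2) (G1 + G2) (\<lambda>\<sigma>. U1 \<sigma> \<and> U2 \<sigma>)"
  by (rule block_definable_combine[OF assms, where b = "(\<and>)"]) blast

lemma block_definable_disj:
  assumes "block_definable X k1 G1 U1" "block_definable X k2 G2 U2"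
  shows "block_definable X (k1 + k2) (G1 + G2) (\<lambda>\<sigma>. U1 \<sigma> \<or> U2 \<sigma>)"
  by (rule block_definable_combine[OF assms, where b = "(\<or>)"]) blast

lemma block_definable_0_combine:
  assumes "block_definable X 0 G1 U1" "block_definable X 0 G2 U2"
  shows "block_definable X 0 (G1 + G2) (\<lambda>\<sigma>. b (U1 \<sigma>) (U2 \<sigma>))"
  using block_definable_combine[OF assms, of b] by simp

text \<open>The coefficient of \<open>x\<close> moves from the parameters to the new block variable
  \<open>k\<close>. The variable \<open>x\<close> stays in \<open>X\<close> with coefficient 0, so
  one fixed \<open>X\<close> serves a whole formula even if a variable is bound repeatedly.\<close>

lemma block_definable_ex:
  assumes U: "block_definable X k G U" and X: "x \<in> X" "finite X"
  shows "block_definable X (Suc k) G (\<lambda>\<sigma>. \<exists>a. U (\<sigma>(x := a)))"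
  using U
proof (rule block_definableE)
  fix F C D w V
  assume F: "finite F" "card F \<le> G" "w < G" "\<And>p. p \<in> F \<Longrightarrow> bounded_by X k (2 ^ w) p"
    "0 < C" "C \<le> 2 ^ w" "1 \<le> D" "D \<le> 2 ^ w"
    and V: "\<And>\<sigma> \<tau> \<sigma>' \<tau>'. similar X k F C D \<sigma> \<tau> \<sigma>' \<tau>' \<Longrightarrow> V \<sigma> \<tau> \<Longrightarrow> V \<sigma>' \<tau>'"
      "\<And>\<sigma>. U \<sigma> \<longleftrightarrow> (\<exists>\<tau>. V \<sigma> \<tau>)"
  define mv :: "form \<Rightarrow> form" where "mv = (\<lambda>p. ((fst p)(x := 0), (snd p)(k := fst p x)))"
  have val_mv: "val X (Suc k) (mv p) \<sigma> \<tau> = val X k p (\<sigma>(x := \<tau> k)) \<tau>" for p \<sigma> \<tau>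
  proof -
    have "(\<Sum>y\<in>X. fst p y * (\<sigma>(x := \<tau> k)) y) = (\<Sum>y\<in>X - {x}. fst p y * \<sigma> y) + fst p x * \<tau> k"
      using X by (simp add: sum.remove[of X x])
    moreover have "(\<Sum>y\<in>X. ((fst p)(x := 0)) y * \<sigma> y) = (\<Sum>y\<in>X - {x}. fst p y * \<sigma> y)"
      using X by (simp add: sum.remove[of X x])
    ultimately show ?thesis
      by (simp add: val_def mv_def)
  qed
  show ?thesis
  proof (rule block_definableI[where F = "mv ` F" and C = C and D = D and w = w and V = "\<lambda>\<sigma> \<tau>. V (\<sigma>(x := \<tau> k)) \<tau>"])
    show "card (mv ` F) \<le> G"
      using card_image_le[OF F(1), of mv] F(2) by linarith
    show "bounded_by X (Suc k) (2 ^ w) p" if p: "p \<in> mv ` F" for p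
    proof -
      obtain q where q: "q \<in> F" "p = mv q" using p by blast
      show ?thesis using F(4)[OF q(1)] X(1) unfolding q(2) bounded_by_def mv_def by (auto simp: less_Suc_eq)
    qed
    show "V (\<sigma>'(x := \<tau>' k)) \<tau>'" if "similar X (Suc k) (mv ` F) C D \<sigma> \<tau> \<sigma>' \<tau>'" "V (\<sigma>(x := \<tau> k)) \<tau>" for \<sigma> \<tau> \<sigma>' \<tau>'
    proof (rule V(1)[OF _ that(2)])
      show "similar X k F C D (\<sigma>(x := \<tau> k)) \<tau> (\<sigma>'(x := \<tau>' k)) \<tau>'"
        using that(1) unfolding similar_def by (simp add: val_mv)
    qed
    show "(\<exists>a. U (\<sigma>(x := a))) \<longleftrightarrow> (\<exists>\<tau>. V (\<sigma>(x := \<tau> k)) \<tau>)" for \<sigma>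
    proof -
      have "V (\<sigma>(x := (\<tau>(k := a)) k)) (\<tau>(k := a))" if "V (\<sigma>(x := a)) \<tau>" for a \<tau>
      proof (rule V(1)[OF _ that])
        have "val X k p \<sigma>' (\<tau>(k := a)) = val X k p \<sigma>' \<tau>" for p \<sigma>'
          by (rule val_cong) simp
        then show "similar X k F C D (\<sigma>(x := a)) \<tau> (\<sigma>(x := (\<tau>(k := a)) k)) (\<tau>(k := a))"
          by (simp add: similar_def)
      qed
      then show ?thesis unfolding V(2) by blast
    qed
  qed (use F(1,3,5-8) in auto)
qed

text \<open>Lifting along \<open>eliminate_block\<close> carries a witness for
  \<open>\<sigma>\<close> to one for any similar \<open>\<sigma>'\<close>, so \<open>U\<close>
  itself is invariant. The strict \<open>w < G\<close> gives
  \<open>(4 * G) ^ k * (w + 1) \<le> (4 * G) ^ k * G\<close>, which is below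
  \<open>(4 * G) ^ (k + 1)\<close>; this power also bounds the at most \<open>G ^ (k + 1)\<close>
  forms.\<close>

lemma block_definable_elim:
  assumes "block_definable X k G U"
  shows "block_definable X 0 ((4 * G) ^ (k + 1)) U"
  using assms
proof (rule block_definableE)
  fix F C D w V
  assume F: "finite F" "card F \<le> G" "w < G" "\<And>p. p \<in> F \<Longrightarrow> bounded_by X k (2 ^ w) p"
    "0 < C" "C \<le> 2 ^ w" "1 \<le> D" "D \<le> 2 ^ w"
    and V: "\<And>\<sigma> \<tau> \<sigma>' \<tau>'. similar X k F C D \<sigma> \<tau> \<sigma>' \<tau>' \<Longrightarrow> V \<sigma> \<tau> \<Longrightarrow> V \<sigma>' \<tau>'"
      "\<And>\<sigma>. U \<sigma> \<longleftrightarrow> (\<exists>\<tau>. V \<sigma> \<tau>)"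
  have "1 \<le> G" using F(3) by simp
  from eliminate_block[OF F(1,2) this F(4-8)] obtain F' D' where
    F': "finite F'" "card F' \<le> G ^ (k + 1)" "\<And>p. p \<in> F' \<Longrightarrow> bounded_by X 0 (2 ^ (4 ^ k * (w + 1))) p"
      "1 \<le> D'" "D' \<le> 2 ^ ((4 * G) ^ k * (w + 1))"
    and similar: "\<And>\<sigma> \<sigma>' \<tau>0 \<tau>. similar X 0 F' (2 ^ (4 ^ k * (w + 1))) D' \<sigma> \<tau>0 \<sigma>' \<tau>0 \<Longrightarrow> \<exists>\<tau>'. similar X k F C D \<sigma> \<tau> \<sigma>' \<tau>'"
    by blast
  let ?w = "(4 * G) ^ k * (w + 1)"
  have "(4::nat) ^ k \<le> (4 * G) ^ k"
    using \<open>1 \<le> G\<close> by (intro power_mono) auto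
  then have le: "(2 :: int) ^ (4 ^ k * (w + 1)) \<le> 2 ^ ?w"
    by (intro power_increasing mult_right_mono) auto
  show ?thesis
  proof (rule block_definableI[where F = F' and C = "2 ^ (4 ^ k * (w + 1))" and D = D' and w = ?w and V = "\<lambda>\<sigma> \<tau>. U \<sigma>"])
    have "G ^ (k + 1) \<le> (4 * G) ^ (k + 1)"
      by (intro power_mono) auto
    then show "card F' \<le> (4 * G) ^ (k + 1)" using F'(2) by linarith
    have "?w \<le> (4 * G) ^ k * G"
      using F(3) by (intro mult_left_mono) auto
    also have "\<dots> < (4 * G) ^ (k + 1)"
      using \<open>1 \<le> G\<close> by simp
    finally show "?w < (4 * G) ^ (k + 1)" .
    show "bounded_by X 0 (2 ^ ?w) p" if "p \<in> F'" for p
      by (rule bounded_by_mono[OF F'(3)[OF that] le])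
    show "U \<sigma>'" if "similar X 0 F' (2 ^ (4 ^ k * (w + 1))) D' \<sigma> \<tau> \<sigma>' \<tau>'" "U \<sigma>" for \<sigma> \<tau> \<sigma>' \<tau>'
      using similar[OF similar_0[OF that(1)]] that(2) V by blast
  qed (use F'(1,4,5) le in auto)
qed

text \<open>The clipping constant is raised to \<open>K = (n + 1) * 2 ^ w\<close>, which dominates
  both \<open>C\<close> and the norm of every form. The exponent counts \<open>G\<close> forms with
  at most \<open>2 ^ (G + n + 1)\<close> clipped values each, and \<open>n\<close> variables with at
  most \<open>2 ^ G\<close> residues each.\<close>

lemma digit_stable_block_definable:
  assumes "block_definable X 0 G U" "finite X" "card X \<le> n" "\<rho> > 0"
  shows "\<exists>\<kappa>. digit_stable \<rho> (2 ^ (G * (G + n + 1) + n * G)) \<kappa> \<and> (\<forall>\<sigma> \<sigma>'. \<kappa> \<sigma> = \<kappa> \<sigma>' \<longrightarrow> (U \<sigma> \<longleftrightarrow> U \<sigma>'))"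
proof -
  obtain F C D w V where F: "finite F" "card F \<le> G" "w < G" "\<And>p. p \<in> F \<Longrightarrow> bounded_by X 0 (2 ^ w) p"
    "0 < C" "C \<le> 2 ^ w" "1 \<le> D" "D \<le> 2 ^ w"
    and V: "\<And>\<sigma> \<tau> \<sigma>' \<tau>'. similar X 0 F C D \<sigma> \<tau> \<sigma>' \<tau>' \<Longrightarrow> V \<sigma> \<tau> \<Longrightarrow> V \<sigma>' \<tau>'"
    "\<And>\<sigma>. U \<sigma> \<longleftrightarrow> (\<exists>\<tau>. V \<sigma> \<tau>)"
    by (rule block_definableE[OF assms(1)]) (rule that)
  define K :: nat where "K = (n + 1) * 2 ^ w"
  define d where "d = nat D"
  have K: "0 < K" "C \<le> int K"
  proof -
    have "(2 :: int) ^ w \<le> (int n + 1) * 2 ^ w" by simp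
    then show "C \<le> int K" using order_trans[OF F(6)] by (simp add: K_def)
    show "0 < K" by (simp add: K_def)
  qed
  have d: "0 < d" "D = int d" "d \<le> 2 ^ w"
    using F(7,8) by (auto simp: d_def nat_le_iff)
  let ?\<kappa> = "\<lambda>p \<sigma>. nat (clip (int K) (\<Sum>x\<in>X. fst p x * \<sigma> x) + int K)"
  \<comment> \<open>A single variable, written as a sum to be an instance of
    \<open>digit_stable_mod\<close>.\<close>
  let ?\<mu> = "\<lambda>x \<sigma>. nat ((\<Sum>y\<in>{x}. 1 * \<sigma> y) mod int d)"
  have "digit_stable \<rho> (2 * K + 1) (?\<kappa> p)" if "p \<in> F" for p
  proof (rule digit_stable_clip[OF _ K(1) assms(4)])
    have "(\<Sum>x\<in>X. \<bar>fst p x\<bar>) \<le> of_nat (card X) * 2 ^ w"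
      using F(4)[OF that] by (intro sum_bounded_above) (auto simp: bounded_by_def)
    also have "\<dots> \<le> int K"
      unfolding K_def of_nat_mult of_nat_power of_nat_numeral
      using assms(3) by (intro mult_right_mono) auto
    finally show "(\<Sum>x\<in>X. \<bar>fst p x\<bar>) \<le> int K" .
  qed
  from digit_stable_family[OF F(1), of \<rho> "2 * K + 1" ?\<kappa>, OF this] obtain \<nu> where
    \<nu>: "digit_stable \<rho> ((2 * K + 1) ^ card F) \<nu>" "\<forall>\<sigma> \<sigma>'. \<nu> \<sigma> = \<nu> \<sigma>' \<longrightarrow> (\<forall>p\<in>F. ?\<kappa> p \<sigma> = ?\<kappa> p \<sigma>')"
    by blast
  from digit_stable_family[OF assms(2), of \<rho> d ?\<mu>, OF digit_stable_mod[OF d(1)]] obtain \<xi> where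
    \<xi>: "digit_stable \<rho> (d ^ card X) \<xi>" "\<forall>\<sigma> \<sigma>'. \<xi> \<sigma> = \<xi> \<sigma>' \<longrightarrow> (\<forall>x\<in>X. ?\<mu> x \<sigma> = ?\<mu> x \<sigma>')"
    by blast
  have U: "U \<sigma>'" if "\<nu> \<sigma> = \<nu> \<sigma>'" "\<xi> \<sigma> = \<xi> \<sigma>'" "U \<sigma>" for \<sigma> \<sigma>'
  proof -
    have "clip C (\<Sum>x\<in>X. fst p x * \<sigma> x) = clip C (\<Sum>x\<in>X. fst p x * \<sigma>' x)" if "p \<in> F" for p
    proof (rule clip_eq_mono[OF _ F(5) K(2)])
      have "?\<kappa> p \<sigma> = ?\<kappa> p \<sigma>'" using \<nu>(2) \<open>\<nu> \<sigma> = \<nu> \<sigma>'\<close> that by blast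
      then show "clip (int K) (\<Sum>x\<in>X. fst p x * \<sigma> x) = clip (int K) (\<Sum>x\<in>X. fst p x * \<sigma>' x)"
        by (simp add: clip_def eq_nat_nat_iff)
    qed
    moreover have "D dvd \<sigma>' x - \<sigma> x" if "x \<in> X" for x
    proof -
      have "?\<mu> x \<sigma> = ?\<mu> x \<sigma>'" using \<xi>(2) \<open>\<xi> \<sigma> = \<xi> \<sigma>'\<close> that by blast
      then have "\<sigma>' x mod D = \<sigma> x mod D" using d by (simp add: eq_nat_nat_iff)
      then show ?thesis by (simp add: mod_eq_dvd_iff)
    qed
    ultimately have "similar X 0 F C D \<sigma> \<tau> \<sigma>' \<tau>" for \<tau>
      by (simp add: similar_def val_def)
    then show ?thesis using V that(3) by blast
  qed
  have "(2 * K + 1) ^ card F * d ^ card X \<le> (2 ^ (G + n + 1)) ^ G * (2 ^ G) ^ n"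
  proof (rule mult_mono)
    have "2 * K + 1 \<le> 2 * (2 * K)" using K(1) by simp
    also have "\<dots> = 4 * (n + 1) * 2 ^ w" by (simp add: K_def algebra_simps)
    also have "\<dots> \<le> 4 * 2 ^ n * 2 ^ w"
      using Suc_leI[OF less_exp[of n]] by (intro mult_mono) simp_all
    also have "\<dots> = 2 ^ (w + n + 2)" by (simp add: power_add)
    also have "\<dots> \<le> 2 ^ (G + n + 1)" using F(3) by (intro power_increasing) auto
    finally have "2 * K + 1 \<le> 2 ^ (G + n + 1)" .
    then have "(2 * K + 1) ^ card F \<le> (2 ^ (G + n + 1)) ^ card F" by (rule power_mono) simp
    also have "\<dots> \<le> (2 ^ (G + n + 1)) ^ G" using F(2) by (intro power_increasing) auto
    finally show "(2 * K + 1) ^ card F \<le> (2 ^ (G + n + 1)) ^ G" .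
    have "d \<le> 2 ^ G" using d(3) power_increasing[of w G "2 :: nat"] F(3) by linarith
    then have "d ^ card X \<le> (2 ^ G) ^ card X" by (rule power_mono) simp
    also have "\<dots> \<le> (2 ^ G) ^ n" using assms(3) by (intro power_increasing) auto
    finally show "d ^ card X \<le> (2 ^ G) ^ n" .
  qed auto
  also have "\<dots> = 2 ^ (G * (G + n + 1) + n * G)"
    using power_add[of "2 :: nat" "G * (G + n + 1)" "n * G"]
    by (simp only: power_mult[symmetric] mult.commute)
  finally have "digit_stable \<rho> (2 ^ (G * (G + n + 1) + n * G)) (\<lambda>\<sigma>. prod_encode (\<nu> \<sigma>, \<xi> \<sigma>))"
    by (rule digit_stable_mono[OF digit_stable_pair[OF \<nu>(1) \<xi>(1)]])
  moreover have "U \<sigma> \<longleftrightarrow> U \<sigma>'" if "prod_encode (\<nu> \<sigma>, \<xi> \<sigma>) = prod_encode (\<nu> \<sigma>', \<xi> \<sigma>')" for \<sigma> \<sigma>'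
  proof -
    have "\<nu> \<sigma> = \<nu> \<sigma>'" "\<xi> \<sigma> = \<xi> \<sigma>'" using that by simp_all
    then show ?thesis using U[of \<sigma> \<sigma>'] U[of \<sigma>' \<sigma>] by argo
  qed
  ultimately show ?thesis by blast
qed

section \<open>Quantifier-free formulas\<close>

text \<open>Bound variables are included, so that the same \<open>X\<close> can be used below
  quantifiers.\<close>

primrec vars_fm :: "fm \<Rightarrow> nat set" where
  "vars_fm (Rel R s t) = vars_tm s \<union> vars_tm t"
| "vars_fm (Dvd d t) = vars_tm t"
| "vars_fm (Neg \<phi>) = vars_fm \<phi>"
| "vars_fm (And \<phi> \<psi>) = vars_fm \<phi> \<union> vars_fm \<psi>"
| "vars_fm (Or \<phi> \<psi>) = vars_fm \<phi> \<union> vars_fm \<psi>"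
| "vars_fm (Imp \<phi> \<psi>) = vars_fm \<phi> \<union> vars_fm \<psi>"
| "vars_fm (Iff \<phi> \<psi>) = vars_fm \<phi> \<union> vars_fm \<psi>"
| "vars_fm (Quant Q x \<phi>) = insert x (vars_fm \<phi>)"

primrec quantifier_free :: "fm \<Rightarrow> bool" where
  "quantifier_free (Rel R s t) \<longleftrightarrow> True"
| "quantifier_free (Dvd d t) \<longleftrightarrow> True"
| "quantifier_free (Neg \<phi>) \<longleftrightarrow> quantifier_free \<phi>"
| "quantifier_free (And \<phi> \<psi>) \<longleftrightarrow> quantifier_free \<phi> \<and> quantifier_free \<psi>"
| "quantifier_free (Or \<phi> \<psi>) \<longleftrightarrow> quantifier_free \<phi> \<and> quantifier_free \<psi>"
| "quantifier_free (Imp \<phi> \<psi>) \<longleftrightarrow> quantifier_free \<phi> \<and> quantifier_free \<psi>"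
| "quantifier_free (Iff \<phi> \<psi>) \<longleftrightarrow> quantifier_free \<phi> \<and> quantifier_free \<psi>"
| "quantifier_free (Quant Q x \<phi>) \<longleftrightarrow> False"

section \<open>Atomic formulas as conditions on linear forms\<close>

primrec coef :: "tm \<Rightarrow> nat \<Rightarrow> int" where
  "coef (Var y) = (\<lambda>x. if x = y then 1 else 0)"
| "coef Zero = (\<lambda>x. 0)"
| "coef One = (\<lambda>x. 0)"
| "coef (Uminus t) = (\<lambda>x. - coef t x)"
| "coef (Plus s t) = (\<lambda>x. coef s x + coef t x)"

primrec const :: "tm \<Rightarrow> int" where
  "const (Var y) = 0"
| "const Zero = 0"
| "const One = 1"
| "const (Uminus t) = - const t"
| "const (Plus s t) = const s + const t"

lemma finite_vars_tm: "finite (vars_tm t)"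
  by (induction t) auto

lemma card_vars_tm: "card (vars_tm t) \<le> len_tm t"
  by (induction t) (auto intro: order_trans[OF card_Un_le])

lemma finite_vars_fm: "finite (vars_fm \<phi>)"
  by (induction \<phi>) (auto simp: finite_vars_tm)

lemma card_vars_fm: "card (vars_fm \<phi>) \<le> len \<phi>"
proof (induction \<phi>)
  case (Rel R s t)
  then show ?case
    using card_Un_le[of "vars_tm s" "vars_tm t"] card_vars_tm[of s] card_vars_tm[of t] by simp
next
  case (Dvd d t)
  then show ?case using card_vars_tm[of t] by simp
next
  case (Quant Q x \<phi>)
  then show ?case using card_insert_le_m1[of "Suc (card (vars_fm \<phi>))" "vars_fm \<phi>" x]
    by (simp add: card_insert_if finite_vars_fm)
qed (auto intro: order_trans[OF card_Un_le])

lemma eval_tm_linear: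
  assumes "finite X" "vars_tm t \<subseteq> X"
  shows "eval_tm \<sigma> t = (\<Sum>x\<in>X. coef t x * \<sigma> x) + const t"
  using assms(2)
proof (induction t)
  case (Var y)
  have "(\<Sum>x\<in>X. (if x = y then 1 else 0) * \<sigma> x) = (\<Sum>x\<in>X. if x = y then \<sigma> x else 0)"
    by (rule sum.cong) auto
  then show ?case using assms(1) Var by simp
qed (auto simp: sum_negf sum.distrib algebra_simps)

text \<open>The norm is at most the number \<open>m\<close> of leaves, and \<open>m\<close> leaves
  are joined by \<open>m - 1\<close> symbols \<open>+\<close>, so the length is at least
  \<open>2 * m - 1\<close>. The factor 2 is what makes the state count for atoms fit below
  \<open>2 ^ n\<close>.\<close>

lemma norm_tm:
  assumes "finite X"
  shows "2 * ((\<Sum>x\<in>X. \<bar>coef t x\<bar>) + \<bar>const t\<bar>) \<le> int (len_tm t) + 1"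
proof (induction t)
  case (Var y)
  have "(\<Sum>x\<in>X. \<bar>if x = y then 1 else 0 :: int\<bar>) = (\<Sum>x\<in>X. if x = y then 1 else 0)"
    by (rule sum.cong) auto
  then show ?case using assms by simp
next
  case (Plus s t)
  have "(\<Sum>x\<in>X. \<bar>coef s x + coef t x\<bar>) \<le> (\<Sum>x\<in>X. \<bar>coef s x\<bar>) + (\<Sum>x\<in>X. \<bar>coef t x\<bar>)"
    by (simp flip: sum.distrib add: sum_mono abs_triangle_ineq)
  then show ?case
    using Plus abs_triangle_ineq[of "const s" "const t"] by simp
qed auto

text \<open>The relation symbol counts as one more \<open>+\<close>, so the estimate for terms
  carries over to the whole atom.\<close>

lemma rel_linear:
  assumes "finite X" "vars_tm s \<union> vars_tm t \<subseteq> X"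
  obtains h d where "\<And>\<sigma>. eval_tm \<sigma> s - eval_tm \<sigma> t = (\<Sum>x\<in>X. h x * \<sigma> x) + d"
    "2 * ((\<Sum>x\<in>X. \<bar>h x\<bar>) + \<bar>d\<bar>) \<le> int (len (Rel R s t)) + 1"
proof (rule that)
  show "eval_tm \<sigma> s - eval_tm \<sigma> t = (\<Sum>x\<in>X. (coef s x - coef t x) * \<sigma> x) + (const s - const t)" for \<sigma>
    using assms eval_tm_linear[of X s] eval_tm_linear[of X t]
    by (simp add: left_diff_distrib sum_subtractf)
  have "(\<Sum>x\<in>X. \<bar>coef s x - coef t x\<bar>) \<le> (\<Sum>x\<in>X. \<bar>coef s x\<bar>) + (\<Sum>x\<in>X. \<bar>coef t x\<bar>)"
    by (simp flip: sum.distrib add: sum_mono abs_triangle_ineq4)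
  then show "2 * ((\<Sum>x\<in>X. \<bar>coef s x - coef t x\<bar>) + \<bar>const s - const t\<bar>) \<le> int (len (Rel R s t)) + 1"
    using norm_tm[OF assms(1), of s] norm_tm[OF assms(1), of t] abs_triangle_ineq4[of "const s" "const t"] by simp
qed

text \<open>This is how constants disappear from the forms: if \<open>u\<close> is saturated at
  \<open>C > \<bar>d\<bar>\<close>, its side alone determines the strict sign of
  \<open>u + d\<close>.\<close>

lemma eval_rel_clip:
  assumes "clip C u = clip C u'" "\<bar>d\<bar> < C" "a - b = u + d" "a' - b' = u' + d"
  shows "eval_rel R a b \<longleftrightarrow> eval_rel R a' b'"
proof -
  have "0 < C" using assms(2) by simp
  then have "u = u' \<or> C \<le> u \<and> C \<le> u' \<or> u \<le> - C \<and> u' \<le> - C"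
    using assms(1) by (simp add: clip_eq_iff)
  then have "(a = b \<longleftrightarrow> a' = b') \<and> (a < b \<longleftrightarrow> a' < b')"
    using assms(2-4) by linarith
  then show ?thesis by (cases R) auto
qed

lemma len_tm_pos: "1 \<le> len_tm t"
  by (induction t) auto

lemma len_ge_3: "wf_fm \<phi> \<Longrightarrow> 3 \<le> len \<phi>"
proof (induction \<phi>)
  case (Rel R s t)
  then show ?case using len_tm_pos[of s] len_tm_pos[of t] by simp
qed auto

lemma add_5_le_power: "3 \<le> l \<Longrightarrow> l + 5 \<le> 2 ^ l" for l :: nat
  by (induction l rule: dec_induct) auto

text \<open>For \<open>qbl \<phi> = 0\<close> the exponent tower collapses and the bound to be
  proved is \<open>2 ^ len \<phi>\<close>, which calls for a direct product of classifiers. The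
  \<open>- 1\<close> reserves the start state; it survives a binary connective because the letter of
  the connective contributes a further factor 2.\<close>

lemma digit_stable_quantifier_free:
  assumes "quantifier_free \<phi>" "wf_fm \<phi>" "\<rho> > 0"
  shows "\<exists>\<kappa>. digit_stable \<rho> (2 ^ len \<phi> - 1) \<kappa> \<and> (\<forall>\<sigma> \<sigma>'. \<kappa> \<sigma> = \<kappa> \<sigma>' \<longrightarrow> (sat \<sigma> \<phi> \<longleftrightarrow> sat \<sigma>' \<phi>))"
    (is "\<exists>\<kappa>. ?P \<phi> \<kappa>")
proof -
  have bin: "\<exists>\<kappa>. ?P \<chi> \<kappa>"
    if ex: "\<exists>\<kappa>. ?P \<phi> \<kappa>" "\<exists>\<kappa>. ?P \<psi> \<kappa>" and len: "len \<chi> = len \<phi> + 1 + len \<psi>"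
      and b: "\<And>\<sigma>. sat \<sigma> \<chi> \<longleftrightarrow> b (sat \<sigma> \<phi>) (sat \<sigma> \<psi>)" for \<chi> \<phi> \<psi> b
  proof -
    obtain \<kappa> \<mu> where \<kappa>: "?P \<phi> \<kappa>" and \<mu>: "?P \<psi> \<mu>" using ex by blast
    have "(2 ^ len \<phi> - 1) * (2 ^ len \<psi> - 1) \<le> (2 ^ len \<phi> * 2 ^ len \<psi> :: nat)"
      by (intro mult_mono) auto
    also have "\<dots> \<le> 2 ^ len \<chi> - 1"
      using one_le_power[of "2 :: nat" "len \<phi> + len \<psi>"] by (simp add: len power_add)
    finally have "digit_stable \<rho> (2 ^ len \<chi> - 1) (\<lambda>\<sigma>. prod_encode (\<kappa> \<sigma>, \<mu> \<sigma>))"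
      using digit_stable_pair \<kappa> \<mu> digit_stable_mono by blast
    moreover have "sat \<sigma> \<chi> \<longleftrightarrow> sat \<sigma>' \<chi>" if "prod_encode (\<kappa> \<sigma>, \<mu> \<sigma>) = prod_encode (\<kappa> \<sigma>', \<mu> \<sigma>')" for \<sigma> \<sigma>'
    proof -
      have "\<kappa> \<sigma> = \<kappa> \<sigma>'" "\<mu> \<sigma> = \<mu> \<sigma>'" using that by simp_all
      then have "sat \<sigma> \<phi> = sat \<sigma>' \<phi>" "sat \<sigma> \<psi> = sat \<sigma>' \<psi>" using \<kappa> \<mu> by blast+
      then show ?thesis unfolding b by (rule arg_cong2)
    qed
    ultimately show ?thesis by blast
  qed
  show ?thesis
    using assms(1,2)
  proof (induction \<phi>)
    case (Rel R s t)
    let ?X = "vars_tm s \<union> vars_tm t" and ?l = "len (Rel R s t)"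
    have fin: "finite ?X" by (simp add: finite_vars_tm)
    obtain h d where h: "\<And>\<sigma>. eval_tm \<sigma> s - eval_tm \<sigma> t = (\<Sum>x\<in>?X. h x * \<sigma> x) + d"
      "2 * ((\<Sum>x\<in>?X. \<bar>h x\<bar>) + \<bar>d\<bar>) \<le> int ?l + 1"
      by (rule rel_linear[OF fin subset_refl, where R = R]) (rule that)
    \<comment> \<open>Large enough for digit stability (the norm) and for deciding the atom (above
      \<open>\<bar>d\<bar>\<close>), with only \<open>2 * C + 1 \<le> ?l + 4\<close>
      classes.\<close>
    define C where "C = nat ((\<Sum>x\<in>?X. \<bar>h x\<bar>) + \<bar>d\<bar> + 1)"
    have pos: "0 \<le> (\<Sum>x\<in>?X. \<bar>h x\<bar>)" by (rule sum_nonneg) simp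
    have C: "(\<Sum>x\<in>?X. \<bar>h x\<bar>) \<le> int C" "0 < C" "\<bar>d\<bar> < int C" "2 * C + 1 \<le> ?l + 4"
      using pos h(2) by (auto simp: C_def)
    let ?\<kappa> = "\<lambda>\<sigma>. nat (clip (int C) (\<Sum>x\<in>?X. h x * \<sigma> x) + int C)"
    have "?l + 5 \<le> 2 ^ ?l"
      using len_ge_3[OF Rel.prems(2)] by (rule add_5_le_power)
    then have "2 * C + 1 \<le> 2 ^ ?l - 1" using C(4) by linarith
    then have "digit_stable \<rho> (2 ^ ?l - 1) ?\<kappa>"
      using digit_stable_clip[OF C(1,2) assms(3)] digit_stable_mono by blast
    moreover have "sat \<sigma> (Rel R s t) \<longleftrightarrow> sat \<sigma>' (Rel R s t)" if "?\<kappa> \<sigma> = ?\<kappa> \<sigma>'" for \<sigma> \<sigma>'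
    proof -
      have "clip (int C) (\<Sum>x\<in>?X. h x * \<sigma> x) = clip (int C) (\<Sum>x\<in>?X. h x * \<sigma>' x)"
        using that by (simp add: clip_def eq_nat_nat_iff)
      then show ?thesis
        unfolding sat.simps by (rule eval_rel_clip[OF _ C(3) h(1) h(1)])
    qed
    ultimately show ?case by blast
  next
    case (Dvd d t)
    let ?X = "vars_tm t"
    let ?\<kappa> = "\<lambda>\<sigma>. nat ((\<Sum>x\<in>?X. coef t x * \<sigma> x) mod int d)"
    have "d > 0" using Dvd by simp
    have "d < 2 ^ d" by (rule less_exp)
    also have "(2::nat) ^ d \<le> 2 ^ len (Dvd d t)" by (rule power_increasing) auto
    finally have "d \<le> 2 ^ len (Dvd d t) - 1"
      by (metis Suc_leI diff_Suc_1 diff_le_mono)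
    then have "digit_stable \<rho> (2 ^ len (Dvd d t) - 1) ?\<kappa>"
      using digit_stable_mod[OF \<open>d > 0\<close>] digit_stable_mono by blast
    moreover have "sat \<sigma> (Dvd d t) \<longleftrightarrow> sat \<sigma>' (Dvd d t)" if "?\<kappa> \<sigma> = ?\<kappa> \<sigma>'" for \<sigma> \<sigma>'
    proof -
      have "(\<Sum>x\<in>?X. coef t x * \<sigma> x) mod int d = (\<Sum>x\<in>?X. coef t x * \<sigma>' x) mod int d"
        using that \<open>d > 0\<close> by (simp add: eq_nat_nat_iff)
      then have "eval_tm \<sigma> t mod int d = eval_tm \<sigma>' t mod int d"
        unfolding eval_tm_linear[OF finite_vars_tm subset_refl] by (rule mod_add_cong) simp
      then show ?thesis by (simp add: dvd_eq_mod_eq_0)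
    qed
    ultimately show ?case by blast
  next
    case (Neg \<phi>)
    have "\<exists>\<kappa>. ?P \<phi> \<kappa>" by (rule Neg.IH) (use Neg.prems in simp_all)
    moreover have "(2::nat) ^ len \<phi> - 1 \<le> 2 ^ len (Neg \<phi>) - 1" by simp
    ultimately show ?case unfolding sat.simps using digit_stable_mono by blast
  next
    case (And \<phi> \<psi>)
    show ?case by (rule bin[where b = "(\<and>)", OF And.IH]) (use And.prems in simp_all)
  next
    case (Or \<phi> \<psi>)
    show ?case by (rule bin[where b = "(\<or>)", OF Or.IH]) (use Or.prems in simp_all)
  next
    case (Imp \<phi> \<psi>)
    show ?case by (rule bin[where b = "(\<longrightarrow>)", OF Imp.IH]) (use Imp.prems in simp_all)
  next
    case (Iff \<phi> \<psi>)
    show ?case by (rule bin[where b = "(=)", OF Iff.IH]) (use Iff.prems in simp_all)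
  qed auto
qed

text \<open>An inequality or equation costs one form with modulus 1, a divisibility only a modulus.
  The logarithms are bounded by \<open>len - 1\<close> at atoms to meet the strict inequality in
  \<open>block_definable\<close>.\<close>

lemma block_definable_quantifier_free:
  assumes "finite X" "quantifier_free \<phi>" "wf_fm \<phi>" "vars_fm \<phi> \<subseteq> X"
  shows "block_definable X 0 (len \<phi>) (\<lambda>\<sigma>. sat \<sigma> \<phi>)"
  using assms(2-)
proof (induction \<phi>)
  case (Rel R s t)
  let ?l = "len (Rel R s t)"
  obtain h d where h: "\<And>\<sigma>. eval_tm \<sigma> s - eval_tm \<sigma> t = (\<Sum>x\<in>X. h x * \<sigma> x) + d"
    "2 * ((\<Sum>x\<in>X. \<bar>h x\<bar>) + \<bar>d\<bar>) \<le> int ?l + 1"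
    by (rule rel_linear[OF assms(1), of s t R]) (use Rel that in auto)
  have pos: "0 \<le> (\<Sum>x\<in>X. \<bar>h x\<bar>)" by (rule sum_nonneg) simp
  have l: "3 \<le> ?l" using len_ge_3 Rel.prems(2) .
  then have "?l + 5 \<le> 2 * 2 ^ (?l - 1)"
    using add_5_le_power[of ?l] by (simp flip: power_Suc)
  then have "int ?l + 5 \<le> 2 * 2 ^ (?l - 1)"
    by (metis (mono_tags) of_nat_le_iff of_nat_add of_nat_mult of_nat_numeral of_nat_power)
  then have le: "(\<Sum>x\<in>X. \<bar>h x\<bar>) + \<bar>d\<bar> + 1 \<le> 2 ^ (?l - 1)"
    using h(2) unfolding distrib_left by presburger
  show ?case
  proof (rule block_definableI[where F = "{(h, \<lambda>_. 0)}" and C = "\<bar>d\<bar> + 1" and D = 1 and w = "?l - 1"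
        and V = "\<lambda>\<sigma> \<tau>. sat \<sigma> (Rel R s t)"])
    have "\<bar>h x\<bar> \<le> 2 ^ (?l - 1)" if "x \<in> X" for x
      using member_le_sum[OF that, of "\<lambda>x. \<bar>h x\<bar>"] assms(1) le by fastforce
    then show "bounded_by X 0 (2 ^ (?l - 1)) p" if "p \<in> {(h, \<lambda>_. 0)}" for p
      using that by (simp add: bounded_by_def)
    show "\<bar>d\<bar> + 1 \<le> 2 ^ (?l - 1)" using le pos by linarith
    show "sat \<sigma>' (Rel R s t)" if "similar X 0 {(h, \<lambda>_. 0)} (\<bar>d\<bar> + 1) 1 \<sigma> \<tau> \<sigma>' \<tau>'" "sat \<sigma> (Rel R s t)" for \<sigma> \<tau> \<sigma>' \<tau>'
    proof -
      have "clip (\<bar>d\<bar> + 1) (\<Sum>x\<in>X. h x * \<sigma> x) = clip (\<bar>d\<bar> + 1) (\<Sum>x\<in>X. h x * \<sigma>' x)"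
        using that(1) by (simp add: similar_def val_def)
      from eval_rel_clip[OF this _ h(1) h(1), of R] that(2) show ?thesis by simp
    qed
  qed (use l in auto)
next
  case (Dvd d t)
  let ?l = "len (Dvd d t)"
  have "d < 2 ^ d" by (rule less_exp)
  also have "(2::nat) ^ d \<le> 2 ^ (?l - 1)" by (rule power_increasing) auto
  finally have "int d \<le> 2 ^ (?l - 1)"
    by (metis less_imp_le of_nat_le_iff of_nat_numeral of_nat_power)
  then show ?case
  proof (intro block_definableI[where F = "{}" and C = 1 and D = "int d" and w = "?l - 1" and V = "\<lambda>\<sigma> \<tau>. sat \<sigma> (Dvd d t)"])
    show "sat \<sigma>' (Dvd d t)" if "similar X 0 {} 1 (int d) \<sigma> \<tau> \<sigma>' \<tau>'" "sat \<sigma> (Dvd d t)" for \<sigma> \<tau> \<sigma>' \<tau>'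
    proof -
      have "eval_tm \<sigma>' t - eval_tm \<sigma> t = (\<Sum>x\<in>X. coef t x * (\<sigma>' x - \<sigma> x))"
        using Dvd.prems eval_tm_linear[OF assms(1)] by (simp add: right_diff_distrib sum_subtractf)
      moreover have "int d dvd (\<Sum>x\<in>X. coef t x * (\<sigma>' x - \<sigma> x))"
        using that(1) by (auto simp: similar_def intro!: dvd_sum dvd_mult)
      ultimately have "int d dvd eval_tm \<sigma>' t - eval_tm \<sigma> t" by simp
      from dvd_add[OF this, of "eval_tm \<sigma> t"] that(2) show ?thesis by simp
    qed
  qed (use Dvd.prems in auto)
next
  case (Neg \<phi>)
  then have "block_definable X 0 (len \<phi>) (\<lambda>\<sigma>. sat \<sigma> \<phi>)" by auto
  from block_definable_mono[OF block_definable_0_compl[OF this], of "len (Neg \<phi>)"] show ?case by simp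
next
  case (And \<phi> \<psi>)
  then show ?case using block_definable_mono[OF block_definable_0_combine[where b = "(\<and>)"], of X "len \<phi>" _ "len \<psi>" _ "len (And \<phi> \<psi>)"] by simp
next
  case (Or \<phi> \<psi>)
  then show ?case using block_definable_mono[OF block_definable_0_combine[where b = "(\<or>)"], of X "len \<phi>" _ "len \<psi>" _ "len (Or \<phi> \<psi>)"] by simp
next
  case (Imp \<phi> \<psi>)
  then show ?case using block_definable_mono[OF block_definable_0_combine[where b = "(\<longrightarrow>)"], of X "len \<phi>" _ "len \<psi>" _ "len (Imp \<phi> \<psi>)"] by simp
next
  case (Iff \<phi> \<psi>)
  then show ?case using block_definable_mono[OF block_definable_0_combine[where b = "(=)"], of X "len \<phi>" _ "len \<psi>" _ "len (Iff \<phi> \<psi>)"] by simp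
qed auto

section \<open>Growth of the bound over quantifier alternations\<close>

text \<open>Solves \<open>growth (m + 1) l = (2\<^sup>B\<^sup>+\<^sup>1 growth m l)\<^sup>B\<^sup>+\<^sup>1\<close>, \<open>growth 0 l = l\<close> up to rounding.\<close>

definition growth :: "nat \<Rightarrow> nat \<Rightarrow> nat \<Rightarrow> nat" where
  "growth B m l = 2 ^ ((B + 3) * ((B + 1) ^ m - 1)) * l ^ ((B + 1) ^ m)"

lemma growth_mono:
  assumes "m \<le> m'" "l \<le> l'" "1 \<le> l"
  shows "growth B m l \<le> growth B m' l'"
proof -
  have le: "(B + 1) ^ m \<le> (B + 1) ^ m'" using assms(1) by (intro power_increasing) auto
  have "l ^ ((B + 1) ^ m) \<le> l ^ ((B + 1) ^ m')" using assms(3) by (intro power_increasing[OF le])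
  also have "\<dots> \<le> l' ^ ((B + 1) ^ m')" using assms(2) by (intro power_mono) auto
  finally show ?thesis
    unfolding growth_def
    by (intro mult_mono[OF power_increasing[OF mult_left_mono[OF diff_le_mono[OF le]]]]) auto
qed

lemma growth_0: "growth B 0 l = l"
  by (simp add: growth_def)

lemma power_superadd: "1 \<le> e \<Longrightarrow> a ^ e + b ^ e \<le> (a + b) ^ e" for a b :: nat
proof (induction e rule: dec_induct)
  case (step e)
  have "a ^ Suc e + b ^ Suc e \<le> (a + b) * (a ^ e + b ^ e)" by (simp add: algebra_simps)
  also have "\<dots> \<le> (a + b) * (a + b) ^ e" using step by (intro mult_left_mono) auto
  finally show ?case by simp
qed simp

text \<open>For fixed \<open>m\<close> the function is a constant times a power of \<open>l\<close>
  with positive exponent, hence superadditive: the bounds of two subformulas fit into that of their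
  total length.\<close>

lemma growth_add: "growth B m a + growth B m b \<le> growth B m (a + b)"
  unfolding growth_def distrib_left[symmetric] by (intro mult_left_mono power_superadd) auto

text \<open>The 4 comes from \<open>block_definable_elim\<close>, and \<open>2 ^ (B - 1)\<close>
  from the equivalences inside the block. Comparing exponents of 2 leaves
  \<open>(B + 1) * (B + 1) \<le> B * (B + 3)\<close>, which holds for \<open>B \<ge> 1\<close>; this
  is the origin of \<open>B + 3\<close> in \<open>growth\<close>.\<close>

lemma growth_step:
  assumes "1 \<le> B" "1 \<le> l"
  shows "(4 * (2 ^ (B - 1) * growth B m l)) ^ (B + 1) \<le> growth B (m + 1) l"
proof -
  let ?X = "(B + 1) ^ m"
  obtain c where c: "?X = Suc c" using not0_implies_Suc[of ?X] by auto
  obtain b where b: "B = Suc b" using assms(1) by (cases B) auto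
  have "4 * (2 ^ (B - 1) * growth B m l) = 2 ^ (B + 1 + (B + 3) * c) * l ^ ?X"
    unfolding growth_def c by (simp add: b power_add)
  then have "(4 * (2 ^ (B - 1) * growth B m l)) ^ (B + 1) = 2 ^ ((B + 1 + (B + 3) * c) * (B + 1)) * l ^ (?X * (B + 1))"
    by (simp only: power_mult_distrib power_mult)
  also have "\<dots> \<le> 2 ^ ((B + 3) * ((B + 1) ^ (m + 1) - 1)) * l ^ (?X * (B + 1))"
  proof (intro mult_right_mono power_increasing)
    have "(B + 1) ^ (m + 1) - 1 = c * (B + 1) + B"
      by (simp only: power_add power_one_right c) simp
    then show "(B + 1 + (B + 3) * c) * (B + 1) \<le> (B + 3) * ((B + 1) ^ (m + 1) - 1)"
      using assms(1) by (simp add: b algebra_simps)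
  qed auto
  also have "\<dots> = growth B (m + 1) l"
    by (simp only: growth_def power_Suc Suc_eq_plus1[symmetric] mult.commute)
  finally show ?thesis .
qed

section \<open>Polarities and the induction over formulas\<close>

lemma dual_dual [simp]: "dual (dual Q) = Q"
  by (cases Q) auto

text \<open>Under the polarity \<open>Forall\<close> the complement is described, so that an
  outermost \<open>Q\<close>-block is existential for either \<open>Q\<close>.\<close>

definition sat_polar :: "quant \<Rightarrow> fm \<Rightarrow> (nat \<Rightarrow> int) \<Rightarrow> bool" where
  "sat_polar Q \<phi> \<sigma> \<longleftrightarrow> (if Q = Exists then sat \<sigma> \<phi> else \<not> sat \<sigma> \<phi>)"

lemma sat_polar_dual: "sat_polar (dual Q) \<phi> \<sigma> \<longleftrightarrow> \<not> sat_polar Q \<phi> \<sigma>"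
  by (cases Q) (auto simp: sat_polar_def)

definition qbl_sum :: "fm \<Rightarrow> nat" where
  "qbl_sum \<phi> = qbl_q Exists \<phi> + qbl_q Forall \<phi>"

lemma qbl_sum_dual: "qbl_sum \<phi> = qbl_q Q \<phi> + qbl_q (dual Q) \<phi>"
  by (cases Q) (auto simp: qbl_sum_def)

lemma quantifier_free_if_qbl_sum_0: "qbl_sum \<phi> = 0 \<Longrightarrow> quantifier_free \<phi>"
proof (induction \<phi>)
  case (Quant Q x \<phi>)
  then show ?case by (cases Q) (auto simp: qbl_sum_def)
qed (auto simp: qbl_sum_def)

lemma qbl_q_quantifier_free: "quantifier_free \<phi> \<Longrightarrow> qbl_q Q \<phi> = 0"
  by (induction \<phi> arbitrary: Q) auto

lemma bound_mono:
  assumes "e \<le> e'" "m \<le> m'" "l \<le> l'" "1 \<le> l"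
  shows "2 ^ e * growth B m l \<le> 2 ^ e' * growth B m' l'"
  using assms by (intro mult_mono power_increasing growth_mono) auto

lemma bound_add:
  assumes "G \<le> 2 ^ e * growth B m a" "H \<le> 2 ^ e * growth B m b" "1 \<le> a"
  shows "G + H \<le> 2 ^ e * growth B m (a + 1 + b)"
proof -
  have "G + H \<le> 2 ^ e * (growth B m a + growth B m b)"
    using assms(1,2) by (simp add: distrib_left)
  also have "\<dots> \<le> 2 ^ e * growth B m (a + 1 + b)"
  proof (rule mult_left_mono)
    have "growth B m (a + b) \<le> growth B m (a + 1 + b)"
      using assms(3) by (intro growth_mono) auto
    then show "growth B m a + growth B m b \<le> growth B m (a + 1 + b)"
      using growth_add[of B m a b] by linarith
  qed simp
  finally show ?thesis .
qed

text \<open>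
  An equivalence uses both polarities of its arguments and so doubles the number of forms. This is
  paid for by the exponent of 2, because it also makes \<open>qbl_q Q\<close> at least the sum \<open>qbl_sum\<close> of the two
  block lengths of the arguments.
\<close>

definition size_bound :: "nat \<Rightarrow> quant \<Rightarrow> fm \<Rightarrow> nat" where
  "size_bound B Q \<phi> = 2 ^ min (qbl_q Q \<phi>) (qbl_sum \<phi> - 1) * growth B (qa_q Q \<phi>) (len \<phi>)"

lemma size_bound_le:
  assumes "wf_fm \<phi>" "min (qbl_q Q \<phi>) (qbl_sum \<phi> - 1) \<le> e" "qa_q Q \<phi> \<le> m"
  shows "size_bound B Q \<phi> \<le> 2 ^ e * growth B m (len \<phi>)"
  unfolding size_bound_def using assms len_ge_3[OF assms(1)] by (intro bound_mono) auto

text \<open>Treats conjunction, disjunction and implication together: complementing exchanges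
  \<open>\<and>\<close> and \<open>\<or>\<close>, so each polarity of each of these connectives
  satisfies one of the two alternatives. The letter of the connective and \<open>bound_add\<close>
  take care of the sum of the bounds.\<close>

lemma block_definable_binary:
  assumes "block_definable X k1 (size_bound B Q1 \<phi>) (sat_polar Q1 \<phi>)" "block_definable X k2 (size_bound B Q2 \<psi>) (sat_polar Q2 \<psi>)"
    and k: "qbl_q Q \<chi> = k1 + k2" "k1 = qbl_q Q1 \<phi>" "k2 = qbl_q Q2 \<psi>"
    and "qbl_sum \<chi> = qbl_sum \<phi> + qbl_sum \<psi>" "qa_q Q \<chi> = max (qa_q Q1 \<phi>) (qa_q Q2 \<psi>)"
    and "len \<chi> = len \<phi> + 1 + len \<psi>" "wf_fm \<phi>" "wf_fm \<psi>"
    and t: "(\<forall>\<sigma>. sat_polar Q \<chi> \<sigma> \<longleftrightarrow> sat_polar Q1 \<phi> \<sigma> \<and> sat_polar Q2 \<psi> \<sigma>) \<or> (\<forall>\<sigma>. sat_polar Q \<chi> \<sigma> \<longleftrightarrow> sat_polar Q1 \<phi> \<sigma> \<or> sat_polar Q2 \<psi> \<sigma>)"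
  shows "block_definable X (qbl_q Q \<chi>) (size_bound B Q \<chi>) (sat_polar Q \<chi>)"
proof (rule block_definable_mono)
  from t show "block_definable X (qbl_q Q \<chi>) (size_bound B Q1 \<phi> + size_bound B Q2 \<psi>) (sat_polar Q \<chi>)"
  proof
    assume "\<forall>\<sigma>. sat_polar Q \<chi> \<sigma> \<longleftrightarrow> sat_polar Q1 \<phi> \<sigma> \<and> sat_polar Q2 \<psi> \<sigma>"
    then have "sat_polar Q \<chi> = (\<lambda>\<sigma>. sat_polar Q1 \<phi> \<sigma> \<and> sat_polar Q2 \<psi> \<sigma>)" by (simp add: fun_eq_iff)
    then show ?thesis using block_definable_conj[OF assms(1,2)] k(1) by simp
  next
    assume "\<forall>\<sigma>. sat_polar Q \<chi> \<sigma> \<longleftrightarrow> sat_polar Q1 \<phi> \<sigma> \<or> sat_polar Q2 \<psi> \<sigma>"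
    then have "sat_polar Q \<chi> = (\<lambda>\<sigma>. sat_polar Q1 \<phi> \<sigma> \<or> sat_polar Q2 \<psi> \<sigma>)" by (simp add: fun_eq_iff)
    then show ?thesis using block_definable_disj[OF assms(1,2)] k(1) by simp
  qed
  show "size_bound B Q1 \<phi> + size_bound B Q2 \<psi> \<le> size_bound B Q \<chi>"
    unfolding size_bound_def[of B Q \<chi>] assms(8)
    using assms len_ge_3[OF assms(9)] qbl_sum_dual[of \<phi> Q1] qbl_sum_dual[of \<psi> Q2]
    by (intro bound_add size_bound_le) auto
qed

text \<open>In polarity \<open>Q\<close> the \<open>Q\<close>-quantifiers met outermost extend the
  open block. A quantifier of the other kind is handled in its own polarity, then its block is
  eliminated and the result complemented. That is the step at which \<open>qa_q Q\<close> grows by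
  one and \<open>qbl_q Q\<close> restarts at 0.\<close>

lemma block_definable_fm:
  assumes "finite X" "1 \<le> B" "wf_fm \<phi>" "vars_fm \<phi> \<subseteq> X"
    "\<And>Q \<psi>. \<psi> \<in> subformulas \<phi> \<Longrightarrow> qbl_q Q \<psi> \<le> B"
  shows "block_definable X (qbl_q Q \<phi>) (size_bound B Q \<phi>) (sat_polar Q \<phi>)"
proof -
  have qf: "block_definable X (qbl_q Q \<phi>) (size_bound B Q \<phi>) (sat_polar Q \<phi>)"
    if "quantifier_free \<phi>" "wf_fm \<phi>" "vars_fm \<phi> \<subseteq> X" for Q \<phi>
  proof -
    have s: "block_definable X 0 (len \<phi>) (\<lambda>\<sigma>. sat \<sigma> \<phi>)"
      using block_definable_quantifier_free[OF assms(1) that] .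
    have "block_definable X 0 (len \<phi>) (sat_polar Q \<phi>)"
      using s block_definable_0_compl[OF s] by (cases Q) (simp_all add: sat_polar_def[abs_def])
    moreover have "len \<phi> \<le> size_bound B Q \<phi>"
      unfolding size_bound_def using growth_mono[of 0 "qa_q Q \<phi>" "len \<phi>" "len \<phi>" B] len_ge_3[OF that(2)]
      by (auto simp: growth_0 intro: order_trans)
    ultimately show ?thesis using qbl_q_quantifier_free[OF that(1)] block_definable_mono by metis
  qed
  show ?thesis
    using assms(3-)
  proof (induction \<phi> arbitrary: Q)
    case (Rel R s t)
    then show ?case by (intro qf) auto
  next
    case (Dvd d t)
    then show ?case by (intro qf) auto
  next
    case (Neg \<phi>)
    have "block_definable X (qbl_q (dual Q) \<phi>) (size_bound B (dual Q) \<phi>) (sat_polar (dual Q) \<phi>)"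
      by (rule Neg.IH) (use Neg.prems in auto)
    moreover have "sat_polar (dual Q) \<phi> = sat_polar Q (Neg \<phi>)" by (cases Q) (auto simp: sat_polar_def fun_eq_iff)
    moreover have "size_bound B (dual Q) \<phi> \<le> size_bound B Q (Neg \<phi>)"
      using Neg.prems(1) len_ge_3[of \<phi>] by (auto simp: size_bound_def qbl_sum_def intro!: bound_mono mult_left_mono growth_mono)
    ultimately show ?case using block_definable_mono by simp
  next
    case (And \<phi> \<psi>)
    have IH: "block_definable X (qbl_q Q \<phi>) (size_bound B Q \<phi>) (sat_polar Q \<phi>)" "block_definable X (qbl_q Q \<psi>) (size_bound B Q \<psi>) (sat_polar Q \<psi>)" for Q
      by (rule And.IH; use And.prems in force)+
    show ?case
      by (rule block_definable_binary[OF IH(1)[of Q] IH(2)[of Q]])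
        (use And.prems in \<open>cases Q; auto simp: qbl_sum_def sat_polar_def\<close>)+
  next
    case (Or \<phi> \<psi>)
    have IH: "block_definable X (qbl_q Q \<phi>) (size_bound B Q \<phi>) (sat_polar Q \<phi>)" "block_definable X (qbl_q Q \<psi>) (size_bound B Q \<psi>) (sat_polar Q \<psi>)" for Q
      by (rule Or.IH; use Or.prems in force)+
    show ?case
      by (rule block_definable_binary[OF IH(1)[of Q] IH(2)[of Q]])
        (use Or.prems in \<open>cases Q; auto simp: qbl_sum_def sat_polar_def\<close>)+
  next
    case (Imp \<phi> \<psi>)
    have IH: "block_definable X (qbl_q Q \<phi>) (size_bound B Q \<phi>) (sat_polar Q \<phi>)" "block_definable X (qbl_q Q \<psi>) (size_bound B Q \<psi>) (sat_polar Q \<psi>)" for Q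
      by (rule Imp.IH; use Imp.prems in force)+
    show ?case
      by (rule block_definable_binary[OF IH(1)[of "dual Q"] IH(2)[of Q]])
        (use Imp.prems in \<open>cases Q; auto simp: qbl_sum_def sat_polar_def\<close>)+
  next
    case (Iff \<phi> \<psi>)
    have IH: "block_definable X (qbl_q Q \<phi>) (size_bound B Q \<phi>) (sat_polar Q \<phi>)" "block_definable X (qbl_q Q \<psi>) (size_bound B Q \<psi>) (sat_polar Q \<psi>)" for Q
      by (rule Iff.IH; use Iff.prems in force)+
    let ?k = "qbl_sum \<phi> + qbl_sum \<psi>" and ?m = "qa_q Q (Iff \<phi> \<psi>)"
    have k: "qbl_q Q (Iff \<phi> \<psi>) = ?k" "qbl_sum (Iff \<phi> \<psi>) = 2 * ?k"
      by (cases Q; simp add: qbl_sum_def)+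
    show ?case
    proof (cases "?k = 0")
      \<comment> \<open>Here the exponent of 2 is 0 and cannot absorb a doubling, but the formula is
        quantifier-free and no polarities have to be separated.\<close>
      case True
      then have "quantifier_free \<phi>" "quantifier_free \<psi>" by (auto intro: quantifier_free_if_qbl_sum_0)
      then show ?thesis using Iff.prems by (intro qf) auto
    next
      case False
      let ?G = "(size_bound B (dual Q) \<phi> + size_bound B Q \<psi>) + (size_bound B (dual Q) \<psi> + size_bound B Q \<phi>)"
      have "block_definable X (qbl_q Q (Iff \<phi> \<psi>)) ?G (sat_polar Q (Iff \<phi> \<psi>))"
      proof (cases Q)
        case Exists
        \<comment> \<open>The two implications use each argument once in each polarity, which is the
          count that \<open>qbl_q\<close> makes for an equivalence.\<close>
        have "sat_polar Q (Iff \<phi> \<psi>) = (\<lambda>\<sigma>. (sat_polar (dual Q) \<phi> \<sigma> \<or> sat_polar Q \<psi> \<sigma>) \<and> (sat_polar (dual Q) \<psi> \<sigma> \<or> sat_polar Q \<phi> \<sigma>))"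
          unfolding Exists by (auto simp: sat_polar_def fun_eq_iff)
        then show ?thesis
          using block_definable_conj[OF block_definable_disj[OF IH(1)[of "dual Q"] IH(2)[of Q]] block_definable_disj[OF IH(2)[of "dual Q"] IH(1)[of Q]]]
          by simp
      next
        case Forall
        have "sat_polar Q (Iff \<phi> \<psi>) = (\<lambda>\<sigma>. (sat_polar (dual Q) \<phi> \<sigma> \<and> sat_polar Q \<psi> \<sigma>) \<or> (sat_polar (dual Q) \<psi> \<sigma> \<and> sat_polar Q \<phi> \<sigma>))"
          unfolding Forall by (auto simp: sat_polar_def fun_eq_iff)
        then show ?thesis
          using block_definable_disj[OF block_definable_conj[OF IH(1)[of "dual Q"] IH(2)[of Q]] block_definable_conj[OF IH(2)[of "dual Q"] IH(1)[of Q]]]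
          by simp
      qed
      moreover have "?G \<le> size_bound B Q (Iff \<phi> \<psi>)"
      proof -
        \<comment> \<open>The term \<open>qbl_sum - 1\<close> in \<open>size_bound\<close> keeps the
          exponents of both arguments at most \<open>?k - 1\<close>, one below that of the
          equivalence; this absorbs the doubling.\<close>
        have le: "size_bound B P \<phi> \<le> 2 ^ (?k - 1) * growth B ?m (len \<phi>)" "size_bound B P \<psi> \<le> 2 ^ (?k - 1) * growth B ?m (len \<psi>)"
          if "P = Q \<or> P = dual Q" for P
          by (rule size_bound_le; use Iff.prems that in \<open>auto\<close>)+
        have 3: "1 \<le> len \<phi>" "1 \<le> len \<psi>" using Iff.prems(1) len_ge_3[of \<phi>] len_ge_3[of \<psi>] by auto
        let ?H = "2 ^ (?k - 1) * growth B ?m (len \<phi> + 1 + len \<psi>)"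
        have "size_bound B (dual Q) \<phi> + size_bound B Q \<psi> \<le> ?H"
          by (rule bound_add[OF le(1) le(2) 3(1)]) auto
        moreover have "size_bound B Q \<phi> + size_bound B (dual Q) \<psi> \<le> ?H"
          by (rule bound_add[OF le(1) le(2) 3(1)]) auto
        ultimately have "?G \<le> 2 * ?H" by linarith
        also have "\<dots> = 2 ^ ?k * growth B ?m (len (Iff \<phi> \<psi>))"
          using False by (cases ?k) auto
        also have "\<dots> = size_bound B Q (Iff \<phi> \<psi>)"
        proof -
          have "min ?k (2 * ?k - 1) = ?k" using False by arith
          then show ?thesis unfolding size_bound_def k by (simp only:)
        qed
        finally show ?thesis .
      qed
      ultimately show ?thesis by (rule block_definable_mono)
    qed
  next
    case (Quant P x \<phi>)
    let ?\<chi> = "Quant P x \<phi>"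
    have IH: "block_definable X (qbl_q P \<phi>) (size_bound B P \<phi>) (sat_polar P \<phi>)"
      by (rule Quant.IH) (use Quant.prems in auto)
    have wf: "wf_fm \<phi>" using Quant.prems by simp
    then have l: "1 \<le> len \<phi>" using len_ge_3[of \<phi>] by simp
    have k: "qbl_q P ?\<chi> = Suc (qbl_q P \<phi>)" "qbl_q (dual P) ?\<chi> = 0" "qbl_sum ?\<chi> = Suc (qbl_q P \<phi>)"
      by (cases P; simp add: qbl_sum_def)+
    have B: "Suc (qbl_q P \<phi>) \<le> B" using Quant.prems(3)[of ?\<chi> P] k by simp
    have "sat_polar P ?\<chi> = (\<lambda>\<sigma>. \<exists>a. sat_polar P \<phi> (\<sigma>(x := a)))"
      by (cases P) (auto simp: sat_polar_def fun_eq_iff)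
    then have ex: "block_definable X (Suc (qbl_q P \<phi>)) (size_bound B P \<phi>) (sat_polar P ?\<chi>)"
      using block_definable_ex[OF IH _ assms(1), of x] Quant.prems(2) by simp
    show ?case
    proof (cases "Q = P")
      case True
      have "size_bound B P \<phi> \<le> 2 ^ qbl_q P \<phi> * growth B (qa_q P ?\<chi>) (len \<phi>)"
        by (rule size_bound_le[OF wf]) auto
      also have "\<dots> \<le> size_bound B P ?\<chi>"
        unfolding size_bound_def k using l by (intro bound_mono) auto
      finally show ?thesis using block_definable_mono[OF ex] k True by simp
    next
      case False
      then have Q: "Q = dual P" by (cases P; cases Q) auto
      \<comment> \<open>The quantifier itself counts towards the block, so the block below it has
        length at most \<open>B - 1\<close>.\<close>
      have "size_bound B P \<phi> \<le> 2 ^ (B - 1) * growth B (qa_q P \<phi>) (len \<phi>)"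
        by (rule size_bound_le[OF wf]) (use B in auto)
      then have "(4 * size_bound B P \<phi>) ^ (Suc (qbl_q P \<phi>) + 1) \<le> (4 * (2 ^ (B - 1) * growth B (qa_q P \<phi>) (len \<phi>))) ^ (Suc (qbl_q P \<phi>) + 1)"
        by (intro power_mono) auto
      also have "\<dots> \<le> (4 * (2 ^ (B - 1) * growth B (qa_q P \<phi>) (len \<phi>))) ^ (B + 1)"
      proof (rule power_increasing)
        have "0 < size_bound B P \<phi>" using block_definable_pos[OF IH] by simp
        then show "1 \<le> 4 * (2 ^ (B - 1) * growth B (qa_q P \<phi>) (len \<phi>))"
          using l by (simp add: growth_def)
      qed (use B in simp)
      also have "\<dots> \<le> growth B (qa_q P \<phi> + 1) (len \<phi>)"
        by (rule growth_step[OF assms(2) l])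
      also have "\<dots> \<le> growth B (qa_q Q ?\<chi>) (len ?\<chi>)"
        using Q False l by (intro growth_mono) auto
      also have "\<dots> = size_bound B Q ?\<chi>" unfolding size_bound_def Q k by (simp only: min_0L power_0 mult_1)
      finally have le: "(4 * size_bound B P \<phi>) ^ (Suc (qbl_q P \<phi>) + 1) \<le> size_bound B Q ?\<chi>" .
      have "sat_polar Q ?\<chi> = (\<lambda>\<sigma>. \<not> sat_polar P ?\<chi> \<sigma>)" by (simp add: Q sat_polar_dual fun_eq_iff)
      then have "block_definable X 0 ((4 * size_bound B P \<phi>) ^ (Suc (qbl_q P \<phi>) + 1)) (sat_polar Q ?\<chi>)"
        using block_definable_0_compl[OF block_definable_elim[OF ex]] by simp
      from block_definable_mono[OF this le] show ?thesis unfolding Q k .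
    qed
  qed
qed


section \<open>The bound on the number of states\<close>

lemma sat_cong: "(\<And>x. x \<in> free_vars \<phi> \<Longrightarrow> \<sigma> x = \<sigma>' x) \<Longrightarrow> sat \<sigma> \<phi> \<longleftrightarrow> sat \<sigma>' \<phi>"
proof (induction \<phi> arbitrary: \<sigma> \<sigma>')
  case (Rel R s t)
  have *: "(\<And>x. x \<in> vars_tm t \<Longrightarrow> \<sigma> x = \<sigma>' x) \<Longrightarrow> eval_tm \<sigma> t = eval_tm \<sigma>' t" for t
    by (induction t) auto
  show ?case using *[of s] *[of t] Rel by simp
next
  case (Dvd d t)
  have *: "(\<And>x. x \<in> vars_tm t \<Longrightarrow> \<sigma> x = \<sigma>' x) \<Longrightarrow> eval_tm \<sigma> t = eval_tm \<sigma>' t" for t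
    by (induction t) auto
  show ?case using *[of t] Dvd by simp
next
  case (Neg \<phi>)
  show ?case using Neg.IH[of \<sigma> \<sigma>'] Neg.prems by simp
next
  case (And \<phi> \<psi>)
  show ?case using And.IH[of \<sigma> \<sigma>'] And.prems by simp
next
  case (Or \<phi> \<psi>)
  show ?case using Or.IH[of \<sigma> \<sigma>'] Or.prems by simp
next
  case (Imp \<phi> \<psi>)
  show ?case using Imp.IH[of \<sigma> \<sigma>'] Imp.prems by simp
next
  case (Iff \<phi> \<psi>)
  show ?case using Iff.IH[of \<sigma> \<sigma>'] Iff.prems by simp
next
  case (Quant Q x \<phi>)
  have "sat (\<sigma>(x := a)) \<phi> \<longleftrightarrow> sat (\<sigma>'(x := a)) \<phi>" for a
    by (rule Quant.IH) (use Quant.prems in auto)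
  then show ?case by (simp split: quant.split)
qed

lemma defined_set_assignment:
  assumes "set xs = free_vars \<phi>"
  shows "defined_set xs \<phi> = {as. length as = length xs \<and> sat (assignment xs as) \<phi>}"
proof -
  have "sat (\<lambda>x. the (map_of (zip xs as) x)) \<phi> \<longleftrightarrow> sat (assignment xs as) \<phi>" for as
    by (rule sat_cong) (simp add: assignment_def assms)
  then show ?thesis by (simp add: defined_set_def)
qed

lemma self_in_subformulas: "\<phi> \<in> subformulas \<phi>"
  by (cases \<phi>) auto

lemma qbl_q_le_qbl:
  assumes "\<psi> \<in> subformulas \<phi>"
  shows "qbl_q Q \<psi> \<le> qbl \<phi>"
  unfolding qbl_def
proof (rule Max_ge)
  show "finite (\<Union>\<psi>\<in>subformulas \<phi>. {qbl_q Exists \<psi>, qbl_q Forall \<psi>})"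
    by (simp add: finite_subformulas)
  show "qbl_q Q \<psi> \<in> (\<Union>\<psi>\<in>subformulas \<phi>. {qbl_q Exists \<psi>, qbl_q Forall \<psi>})"
    using assms by (cases Q) auto
qed

lemma len_ge_5: "wf_fm \<phi> \<Longrightarrow> \<not> quantifier_free \<phi> \<Longrightarrow> 5 \<le> len \<phi>"
proof (induction \<phi>)
  case (Quant Q x \<phi>)
  then show ?case using len_ge_3[of \<phi>] by simp
qed auto

text \<open>With \<open>b = B + 1\<close> and \<open>X = b ^ m\<close>, \<open>G\<close> is the
  \<open>b\<close>-th power of \<open>2 ^ ((b + 2) * X - 1) * n ^ X\<close>. Since
  \<open>4 \<le> n\<close>, squaring \<open>G\<close> turns the power of 2 into the same power of
  \<open>n\<close>, and the constant 5 is at most one more factor \<open>n\<close>, made up for by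
  the \<open>- 1\<close>. The total exponent is at most
  \<open>b * (b + 4) * X \<le> b ^ 4 * X\<close> because \<open>b + 4 \<le> b ^ 3\<close> for
  \<open>b \<ge> 2\<close>; hence the 4 in the theorem.\<close>

lemma final_exponent:
  assumes "1 \<le> B" "5 \<le> n" and G_def: "G = (4 * (2 ^ B * growth B m n)) ^ (B + 1)"
  shows "G * (G + n + 1) + n * G + 1 \<le> n ^ ((B + 1) ^ (m + 4))"
proof -
  define b where "b = B + 1"
  define X where "X = b ^ m"
  have b: "2 \<le> b" using assms(1) by (simp add: b_def)
  have X: "1 \<le> X" using b by (simp add: X_def)
  have n: "1 \<le> n" using assms(2) by simp
  have "4 * (2 ^ B * growth B m n) = 2 ^ (2 + B + (B + 3) * (X - 1)) * n ^ X"
    by (simp add: growth_def X_def b_def power_add)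
  also have "2 + B + (B + 3) * (X - 1) = (b + 2) * X - 1"
    using X by (cases X) (auto simp: b_def algebra_simps)
  finally have G: "G = (2 ^ ((b + 2) * X - 1) * n ^ X) ^ b"
    by (simp only: G_def b_def)
  have nX: "n \<le> n ^ X" using X n self_le_power[of n X] by simp
  have "n ^ X \<le> 2 ^ ((b + 2) * X - 1) * n ^ X" by simp
  also have "\<dots> \<le> G"
    unfolding G using b n by (intro self_le_power) auto
  finally have nG: "n \<le> G" using nX by linarith
  have "G * (G + n + 1) + n * G + 1 \<le> 5 * (G * G)"
  proof -
    have G1: "1 \<le> G" using nG n by simp
    have "n * G \<le> G * G" using nG by (rule mult_right_mono) simp
    moreover have "1 * G \<le> G * G" using G1 by (rule mult_right_mono) simp
    moreover have "G * (G + n + 1) = G * G + n * G + 1 * G"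
      by (simp add: distrib_left mult.commute)
    ultimately show ?thesis using G1 by linarith
  qed
  also have "\<dots> \<le> n * (G * G)"
    using assms(2) by (rule mult_right_mono) simp
  also have "\<dots> \<le> n * n ^ (b * ((b + 4) * X - 1))"
  proof (rule mult_left_mono)
    have "G * G = ((2 ^ ((b + 2) * X - 1) * n ^ X) ^ 2) ^ b"
      unfolding G by (simp add: power2_eq_square power_mult_distrib)
    also have "(2 ^ ((b + 2) * X - 1) * n ^ X) ^ 2 = 4 ^ ((b + 2) * X - 1) * n ^ (2 * X)"
    proof -
      have 4: "(2 ^ e) ^ 2 = (4 :: nat) ^ e" for e
        using power_mult[of "2 :: nat" 2 e] power_mult[of "2 :: nat" e 2] by (simp add: mult.commute)
      then show ?thesis
        unfolding power_mult_distrib 4 by (simp only: power_mult[symmetric] mult.commute)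
    qed
    also have "(4 ^ ((b + 2) * X - 1) * n ^ (2 * X)) ^ b \<le> (n ^ ((b + 2) * X - 1) * n ^ (2 * X)) ^ b"
      using assms(2) by (intro power_mono mult_right_mono) auto
    also have "n ^ ((b + 2) * X - 1) * n ^ (2 * X) = n ^ ((b + 4) * X - 1)"
    proof -
      have "(b + 2) * X - 1 + 2 * X = (b + 4) * X - 1"
        using X by (cases X) (auto simp: algebra_simps)
      then show ?thesis by (simp only: power_add[symmetric])
    qed
    finally show "G * G \<le> n ^ (b * ((b + 4) * X - 1))"
      by (simp only: power_mult[symmetric] mult.commute)
  qed simp
  also have "\<dots> = n ^ (b * ((b + 4) * X - 1) + 1)" by simp
  also have "\<dots> \<le> n ^ (b ^ (m + 4))"
  proof (rule power_increasing[OF _ n])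
    have "b * ((b + 4) * X - 1) + 1 \<le> b * ((b + 4) * X)"
    proof -
      obtain c where "(b + 4) * X = Suc c" using X b not0_implies_Suc[of "(b + 4) * X"] by auto
      then show ?thesis using b by simp
    qed
    also have "\<dots> \<le> b * (b * b * b * X)"
    proof (intro mult_left_mono mult_right_mono)
      have "b + 4 \<le> 4 * b" using b by simp
      also have "\<dots> \<le> b * b * b" using mult_mono[OF b b] by (intro mult_right_mono) auto
      finally show "b + 4 \<le> b * b * b" .
    qed auto
    also have "\<dots> = b ^ (m + 4)"
      by (simp add: X_def power_add power4_eq_xxxx)
    finally show "b * ((b + 4) * X - 1) + 1 \<le> b ^ (m + 4)" .
  qed
  finally show ?thesis by (simp add: b_def)
qed

theorem theorem4p6:
  fixes \<rho> :: nat and \<phi> :: fm and xs :: "nat list"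
  assumes "\<rho> \<ge> 2"
    and "wf_fm \<phi>"
    and "distinct xs" and "set xs = free_vars \<phi>"
  shows "(\<exists>A. minimal_dwa \<rho> (length xs) A (defined_set xs \<phi>)) \<and>
    (\<forall>A. minimal_dwa \<rho> (length xs) A (defined_set xs \<phi>) \<longrightarrow>
       card (states A) \<le> 2 ^ (len \<phi> ^ ((qbl \<phi> + 1) ^ (qa \<phi> + 4))))"
proof -
  let ?n = "len \<phi>" and ?K = "(2 :: nat) ^ (len \<phi> ^ ((qbl \<phi> + 1) ^ (qa \<phi> + 4)))"
  have \<rho>: "\<rho> > 0" using assms(1) by simp
  have "\<exists>\<kappa> S. digit_stable \<rho> S \<kappa> \<and> (\<forall>\<sigma> \<sigma>'. \<kappa> \<sigma> = \<kappa> \<sigma>' \<longrightarrow> (sat \<sigma> \<phi> \<longleftrightarrow> sat \<sigma>' \<phi>)) \<and> S + 1 \<le> ?K"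
  proof (cases "quantifier_free \<phi>")
    case True
    have "?n \<le> ?n ^ ((qbl \<phi> + 1) ^ (qa \<phi> + 4))"
      using len_ge_3[OF assms(2)] by (intro self_le_power) auto
    then have "2 ^ ?n \<le> ?K" by (intro power_increasing) auto
    then have "(2 ^ ?n - 1) + 1 \<le> ?K" by simp
    then show ?thesis using digit_stable_quantifier_free[OF True assms(2) \<rho>] by blast
  next
    case False
    define B where "B = qbl \<phi>"
    have "0 < qbl_sum \<phi>" using False quantifier_free_if_qbl_sum_0 by blast
    then have B: "1 \<le> B"
      using qbl_q_le_qbl[OF self_in_subformulas, of Exists \<phi>] qbl_q_le_qbl[OF self_in_subformulas, of Forall \<phi>]
      unfolding B_def qbl_sum_def by linarith
    have n: "5 \<le> ?n" using len_ge_5[OF assms(2) False] .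
    \<comment> \<open>The polarity attaining the minimum in \<open>qa\<close>. If it is
      \<open>Forall\<close>, the complement is classified, which gives the same classes.\<close>
    obtain Q where Q: "qa_q Q \<phi> = qa \<phi>"
      by (cases "qa_q Exists \<phi> \<le> qa_q Forall \<phi>") (auto simp: qa_def min_def)
    have k: "qbl_q Q \<phi> \<le> B" unfolding B_def by (rule qbl_q_le_qbl[OF self_in_subformulas])
    have s: "block_definable (vars_fm \<phi>) (qbl_q Q \<phi>) (size_bound B Q \<phi>) (sat_polar Q \<phi>)"
      using finite_vars_fm B assms(2) by (intro block_definable_fm) (auto simp: B_def qbl_q_le_qbl)
    \<comment> \<open>One last elimination, of the outermost block. It may have the full length
      \<open>B\<close>, hence \<open>2 ^ B\<close> instead of \<open>2 ^ (B - 1)\<close>.\<close>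
    define G where "G = (4 * (2 ^ B * growth B (qa \<phi>) ?n)) ^ (B + 1)"
    have "size_bound B Q \<phi> \<le> 2 ^ B * growth B (qa \<phi>) ?n"
      by (rule size_bound_le[OF assms(2)]) (use k Q in auto)
    then have "(4 * size_bound B Q \<phi>) ^ (qbl_q Q \<phi> + 1) \<le> (4 * (2 ^ B * growth B (qa \<phi>) ?n)) ^ (qbl_q Q \<phi> + 1)"
      by (intro power_mono) auto
    also have "\<dots> \<le> G"
      unfolding G_def using k n by (intro power_increasing) (auto simp: growth_def)
    finally have s: "block_definable (vars_fm \<phi>) 0 G (sat_polar Q \<phi>)"
      using block_definable_mono[OF block_definable_elim[OF s]] by blast
    obtain \<kappa> where \<kappa>: "digit_stable \<rho> (2 ^ (G * (G + ?n + 1) + ?n * G)) \<kappa>"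
      "\<forall>\<sigma> \<sigma>'. \<kappa> \<sigma> = \<kappa> \<sigma>' \<longrightarrow> (sat_polar Q \<phi> \<sigma> \<longleftrightarrow> sat_polar Q \<phi> \<sigma>')"
      using digit_stable_block_definable[OF s finite_vars_fm card_vars_fm \<rho>] by blast
    have "\<forall>\<sigma> \<sigma>'. \<kappa> \<sigma> = \<kappa> \<sigma>' \<longrightarrow> (sat \<sigma> \<phi> \<longleftrightarrow> sat \<sigma>' \<phi>)"
    proof (intro allI impI)
      fix \<sigma> \<sigma>'
      assume "\<kappa> \<sigma> = \<kappa> \<sigma>'"
      then have "sat_polar Q \<phi> \<sigma> \<longleftrightarrow> sat_polar Q \<phi> \<sigma>'" using \<kappa>(2) by blast
      then show "sat \<sigma> \<phi> \<longleftrightarrow> sat \<sigma>' \<phi>" by (cases Q) (simp_all add: sat_polar_def)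
    qed
    \<comment> \<open>The \<open>+ 1\<close> is the start state; it is paid for by one more in the
      exponent.\<close>
    moreover have "2 ^ (G * (G + ?n + 1) + ?n * G) + 1 \<le> ?K"
    proof -
      have "2 ^ (G * (G + ?n + 1) + ?n * G) + 1 \<le> (2 :: nat) ^ (G * (G + ?n + 1) + ?n * G + 1)" by simp
      also have "\<dots> \<le> ?K"
        using final_exponent[OF B n G_def] unfolding B_def[symmetric]
        by (intro power_increasing) auto
      finally show ?thesis .
    qed
    ultimately show ?thesis using \<kappa>(1) by blast
  qed
  then obtain \<kappa> S where \<kappa>: "digit_stable \<rho> S \<kappa>" "\<And>\<sigma> \<sigma>'. \<kappa> \<sigma> = \<kappa> \<sigma>' \<Longrightarrow> sat \<sigma> \<phi> \<longleftrightarrow> sat \<sigma>' \<phi>" and S: "S + 1 \<le> ?K"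
    by blast
  obtain A :: "(nat, nat list) dwa" where "represents \<rho> (length xs) A (defined_set xs \<phi>)" "card (states A) \<le> ?K"
    using dwa_of_digit_stable[OF \<kappa>(1), of "\<lambda>\<sigma>. sat \<sigma> \<phi>" xs, OF \<kappa>(2) assms(3) \<rho>] S
    unfolding defined_set_assignment[OF assms(4)] by (meson order_trans)
  then show ?thesis by (rule minimal_dwa_bound)
qed

end
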